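(* The dimensions of the relative cochain spaces $C^{m}_{GF}(\mathfrak{ham}_4^0,Sp(4,\mathbb{R}))_4$ of weight $4$ in degrees $m=0,1,2,3,4$ are $0,0,0,1,3$ respectively. Thus the Euler characteristic number of weight $4$ is $(-1)^0\cdot 0+(-1)^3\cdot 1+(-1)^4\cdot 3=2$.
   Context: On $\mathbb{R}^4$ with coordinates $x_1,x_2,x_3,x_4$ use the Poisson bracket $\{f,g\}=\frac{\partial f}{\partial x_1}\frac{\partial g}{\partial x_4}+\frac{\partial f}{\partial x_2}\frac{\partial g}{\partial x_3}-\frac{\partial f}{\partial x_3}\frac{\partial g}{\partial x_2}-\frac{\partial f}{\partial x_4}\frac{\partial g}{\partial x_1}$. Let $\mathfrak{ham}_4^0$ be the Lie algebra of Hamiltonian vector fields with polynomial potentials vanishing at the origin, identified with the Lie algebra, under $\{\cdot,\cdot\}$, of real polynomials all of whose homogeneous components have degree $\ge 2$. Let $\mathfrak{S}_\ell$ be the dual space of the space of homogeneous polynomials of degree $\ell$. Nonzero elements of $\mathfrak{S}_\ell$ have weight $\ell-2$, and nonzero elements of $\mathfrak{S}_{\ell_1}\wedge\cdots\wedge\mathfrak{S}_{\ell_s}$ have weight $\sum_i(\ell_i-2)$. The degree $m$, weight $w$ cochain space is $$C^m_{GF}(\mathfrak{ham}_4^0)_w=\bigoplus \Lambda^{k_2}\mathfrak{S}_2\wedge\Lambda^{k_3}\mathfrak{S}_3\wedge\cdots\wedge\Lambda^{k_s}\mathfrak{S}_s,$$ the sum being over all finite sequences of non-negative integers $(k_2,k_3,\dots)$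 with $\sum_i k_i=m$ and $\sum_i k_i(i-2)=w$. The coboundary operator $d$ is the (degree $+1$) antiderivation determined on $1$-cochains by $(d z)(f,g)=-\langle z,\{f,g\}\rangle$; it preserves weight. The relative cochain space $C^m_{GF}(\mathfrak{ham}_4^0,Sp(4,\mathbb{R}))_w$ consists of those $\sigma\in C^m_{GF}(\mathfrak{ham}_4^0)_w$ with $i_{\hat J(\xi)}\sigma=0$ and $i_{\hat J(\xi)}d\sigma=0$ for all $\xi\in\mathfrak{sp}(4,\mathbb{R})$, where $J$ is the momentum mapping of the linear action of $Sp(4,\mathbb{R})$ on $\mathbb{R}^4$, so that $\hat J(\xi)$ ranges over all homogeneous quadratic polynomials, and $i$ denotes interior product. (Equivalently, it is the space of $Sp(4,\mathbb{R})$-invariant cochains in which $\mathfrak{S}_2$ does not appear.) The Euler characteristic number of weight $w$ is $\sum_m(-1)^m\dim C^m_{GF}(\mathfrak{ham}_4^0,Sp(4,\mathbb{R}))_w$. *)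

theory Defs
  imports
    "HOL-Analysis.Analysis"
    "HOL-Analysis.Finite_Function_Topology"
    "HOL-Library.Function_Algebras"
begin

section \<open>Real polynomials in four variables\<close>

text \<open>
  A polynomial is the finitely supported family of its coefficients; the exponent vector
  \<open>\<alpha>\<close> stands for the monomial \<open>x\<^sub>1^(\<alpha>$1) x\<^sub>2^(\<alpha>$2) x\<^sub>3^(\<alpha>$3) x\<^sub>4^(\<alpha>$4)\<close>.
  The four elements of the index type are named \<open>1\<close>, \<open>2\<close>, \<open>3\<close>, \<open>4\<close>
  (in that type \<open>4 = 0\<close>, which is harmless).
\<close>

type_synonym poly4 = "(nat ^ 4) \<Rightarrow>\<^sub>0 real"

definition tdeg :: "nat ^ 4 \<Rightarrow> nat"
  where "tdeg \<alpha> = (\<Sum>i\<in>UNIV. \<alpha> $ i)"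

text \<open>
  If \<open>\<alpha> $ i = 0\<close>, the subtraction of exponents truncates, but the coefficient is then zero.
\<close>

definition pd :: "4 \<Rightarrow> poly4 \<Rightarrow> poly4"
  where "pd i p =
    (\<Sum>\<alpha>\<in>Poly_Mapping.keys p.
       Poly_Mapping.single (\<alpha> - axis i 1) (real (\<alpha> $ i) * Poly_Mapping.lookup p \<alpha>))"

definition poisson :: "poly4 \<Rightarrow> poly4 \<Rightarrow> poly4"
  where "poisson f g = pd 1 f * pd 4 g + pd 2 f * pd 3 g - pd 3 f * pd 2 g - pd 4 f * pd 1 g"

lemma tdeg_add: "tdeg (\<alpha> + \<beta>) = tdeg \<alpha> + tdeg \<beta>"
  by (simp add: tdeg_def sum.distrib)

lemma keys_pd:
  assumes "\<beta> \<in> Poly_Mapping.keys (pd i p)"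
  shows "\<exists>\<alpha>\<in>Poly_Mapping.keys p. tdeg \<alpha> = Suc (tdeg \<beta>)"
proof -
  have "\<beta> \<in> (\<Union>\<alpha>\<in>Poly_Mapping.keys p. Poly_Mapping.keys
      (Poly_Mapping.single (\<alpha> - axis i 1) (real (\<alpha> $ i) * Poly_Mapping.lookup p \<alpha>)))"
    using assms unfolding pd_def by (rule subsetD[OF Poly_Mapping.keys_sum, rotated])
  then obtain \<alpha> where \<alpha>: "\<alpha> \<in> Poly_Mapping.keys p"
    and "\<beta> \<in> Poly_Mapping.keys
      (Poly_Mapping.single (\<alpha> - axis i 1) (real (\<alpha> $ i) * Poly_Mapping.lookup p \<alpha>))"
    by blast
  then have "\<beta> = \<alpha> - axis i 1" and nz: "\<alpha> $ i \<noteq> 0"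
    by (simp_all split: if_splits)
  then have "\<alpha> $ j = \<beta> $ j + (if j = i then 1 else 0)" for j
    by (simp add: axis_def)
  then have "tdeg \<alpha> = tdeg \<beta> + (\<Sum>j\<in>UNIV. if j = i then 1 else 0)"
    by (simp add: tdeg_def sum.distrib)
  also have "(\<Sum>j\<in>UNIV. if j = i then 1 else 0) = (1 :: nat)"
    by (subst sum.delta) simp_all
  finally show ?thesis using \<alpha> by auto
qed


section \<open>The Lie algebra\<close>

typedef ham = "{p :: poly4. \<forall>\<alpha>\<in>Poly_Mapping.keys p. 2 \<le> tdeg \<alpha>}"
  morphisms potential Ham
  by (rule exI[of _ 0]) simp

setup_lifting type_definition_ham

instantiation ham :: real_vector
begin

lift_definition zero_ham :: ham is 0 by simp

lift_definition plus_ham :: "ham \<Rightarrow> ham \<Rightarrow> ham" is "(+)"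
  by (meson Poly_Mapping.keys_add Un_iff subsetD)

lift_definition minus_ham :: "ham \<Rightarrow> ham \<Rightarrow> ham" is "(-)"
  by (meson Poly_Mapping.keys_diff Un_iff subsetD)

lift_definition uminus_ham :: "ham \<Rightarrow> ham" is uminus
  by simp

lift_definition scaleR_ham :: "real \<Rightarrow> ham \<Rightarrow> ham" is "scaleR"
  by (auto simp: in_keys_iff scaleR_poly_mapping_def)

instance
  by standard (transfer; simp add: algebra_simps)+

end

lemma keys_pd_mult:
  assumes "\<forall>\<alpha>\<in>Poly_Mapping.keys p. 2 \<le> tdeg \<alpha>" "\<forall>\<alpha>\<in>Poly_Mapping.keys q. 2 \<le> tdeg \<alpha>"
    and "\<gamma> \<in> Poly_Mapping.keys (pd i p * pd j q)"
  shows "2 \<le> tdeg \<gamma>"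
proof -
  obtain \<alpha> \<beta> where "\<gamma> = \<alpha> + \<beta>" "\<alpha> \<in> Poly_Mapping.keys (pd i p)" "\<beta> \<in> Poly_Mapping.keys (pd j q)"
    using assms(3) keys_mult[of "pd i p" "pd j q"] by blast
  with keys_pd[of \<alpha> i p] keys_pd[of \<beta> j q] assms(1,2) show ?thesis
    by (fastforce simp: tdeg_add)
qed

lemma keys_poisson:
  assumes "\<forall>\<alpha>\<in>Poly_Mapping.keys p. 2 \<le> tdeg \<alpha>" "\<forall>\<alpha>\<in>Poly_Mapping.keys q. 2 \<le> tdeg \<alpha>"
  shows "\<forall>\<alpha>\<in>Poly_Mapping.keys (poisson p q). 2 \<le> tdeg \<alpha>"
proof
  fix \<gamma> assume "\<gamma> \<in> Poly_Mapping.keys (poisson p q)"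
  then have "\<gamma> \<in> Poly_Mapping.keys (pd 1 p * pd 4 q) \<union> Poly_Mapping.keys (pd 2 p * pd 3 q) \<union>
      Poly_Mapping.keys (pd 3 p * pd 2 q) \<union> Poly_Mapping.keys (pd 4 p * pd 1 q)"
    unfolding poisson_def
    using Poly_Mapping.keys_add[of "pd 1 p * pd 4 q" "pd 2 p * pd 3 q"]
      Poly_Mapping.keys_diff[of "pd 1 p * pd 4 q + pd 2 p * pd 3 q" "pd 3 p * pd 2 q"]
      Poly_Mapping.keys_diff[of "pd 1 p * pd 4 q + pd 2 p * pd 3 q - pd 3 p * pd 2 q" "pd 4 p * pd 1 q"]
    by blast
  then show "2 \<le> tdeg \<gamma>"
    using keys_pd_mult[OF assms] by blast
qed

lift_definition bracket :: "ham \<Rightarrow> ham \<Rightarrow> ham" is poisson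
  using keys_poisson by blast

definition homogeneous :: "nat \<Rightarrow> ham set"
  where "homogeneous l = {f. \<forall>\<alpha>\<in>Poly_Mapping.keys (potential f). tdeg \<alpha> = l}"

text \<open>
  The dual space of the homogeneous polynomials of degree \<open>l\<close>: a functional on homogeneous
  polynomials of degree \<open>l\<close> is extended to the whole Lie algebra by zero on the other degrees.
\<close>

definition dual_homogeneous :: "nat \<Rightarrow> (ham \<Rightarrow> real) set"
  where "dual_homogeneous l = {z. linear z \<and> (\<forall>k. k \<noteq> l \<longrightarrow> (\<forall>f\<in>homogeneous k. z f = 0))}"


section \<open>Exterior forms\<close>

text \<open>
  An \<open>m\<close>-form is the function of an argument list whose value is that of the alternating
  \<open>m\<close>-linear map on lists of length \<open>m\<close> and zero on lists of any other length.
\<close>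

type_synonym form = "ham list \<Rightarrow> real"

instantiation "fun" :: (type, real_vector) real_vector
begin

definition scaleR_fun :: "real \<Rightarrow> ('a \<Rightarrow> 'b) \<Rightarrow> 'a \<Rightarrow> 'b"
  where "scaleR_fun c f = (\<lambda>x. c *\<^sub>R f x)"

instance
  by standard (simp_all add: scaleR_fun_def plus_fun_def algebra_simps)

end

lemma scaleR_fun_apply [simp]: "(c *\<^sub>R f) x = c *\<^sub>R f x"
  by (simp add: scaleR_fun_def)

definition contract :: "ham \<Rightarrow> form \<Rightarrow> form"
  where "contract f \<sigma> = (\<lambda>fs. \<sigma> (f # fs))"

definition one_form :: "(ham \<Rightarrow> real) \<Rightarrow> form"
  where "one_form z fs = (case fs of [f] \<Rightarrow> z f | _ \<Rightarrow> 0)"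

definition unit_form :: form
  where "unit_form fs = (if fs = [] then 1 else 0)"

text \<open>The sign \<open>(-1)^m\<close> on \<open>m\<close>-forms.\<close>

definition grading :: "form \<Rightarrow> form"
  where "grading \<sigma> = (\<lambda>fs. (- 1) ^ length fs * \<sigma> fs)"

text \<open>
  The exterior product, normalised so that a product of one-forms evaluates to the determinant.
  The recursion is \<open>i_f (\<alpha> \<and> \<beta>) = i_f \<alpha> \<and> \<beta> + (-1)^m \<alpha> \<and> i_f \<beta>\<close> for an \<open>m\<close>-form \<open>\<alpha>\<close>;
  unfolding it yields the usual signed sum over shuffles.
\<close>

fun wedge :: "form \<Rightarrow> form \<Rightarrow> form"
  where
    "wedge \<alpha> \<beta> [] = \<alpha> [] * \<beta> []"
  | "wedge \<alpha> \<beta> (f # fs) = wedge (contract f \<alpha>) \<beta> fs + wedge (grading \<alpha>) (contract f \<beta>) fs"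

definition wedge_list :: "(ham \<Rightarrow> real) list \<Rightarrow> form"
  where "wedge_list zs = foldr (\<lambda>z. wedge (one_form z)) zs unit_form"

definition exterior_algebra :: "form set"
  where "exterior_algebra =
    span {wedge_list zs | zs. \<forall>z\<in>set zs. \<exists>l\<ge>2. z \<in> dual_homogeneous l}"


section \<open>Cochains of given degree and weight\<close>

text \<open>
  A list \<open>ks = [k\<^sub>2, k\<^sub>3, \<dots>]\<close> of multiplicities is indexed from 0, so its entry at
  position \<open>i\<close> counts the factors from the dual space of degree \<open>i + 2\<close>, of weight \<open>i\<close>.
\<close>

definition degree_list :: "nat list \<Rightarrow> nat list"
  where "degree_list ks = concat (map (\<lambda>i. replicate (ks ! i) (i + 2)) [0..<length ks])"

definition cochain_summand :: "nat list \<Rightarrow> form set"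
  where "cochain_summand ks =
    span {wedge_list zs | zs. list_all2 (\<lambda>l z. z \<in> dual_homogeneous l) (degree_list ks) zs}"

text \<open>
  The summands belonging to different multiplicities are linearly independent, hence the direct
  sum is the span of their union. Trailing zeros in \<open>ks\<close> do not change the summand.
\<close>

definition cochains :: "nat \<Rightarrow> nat \<Rightarrow> form set"
  where "cochains m w =
    span (\<Union>{cochain_summand ks | ks. sum_list ks = m \<and> (\<Sum>i<length ks. ks ! i * i) = w})"


section \<open>The coboundary operator\<close>

text \<open>
  Evaluated on \<open>(f\<^sub>0, \<dots>, f\<^sub>m)\<close>, this is
  \<open>\<Sum>i<j. (-1)^(i+1) \<sigma>(f\<^sub>0, \<dots>, f\<^sub>i omitted, \<dots>, {f\<^sub>i, f\<^sub>j} in place of f\<^sub>j, \<dots>, f\<^sub>m)\<close>,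
  written as the recursion \<open>i_f d = L_f - d i_f\<close>.  The facts \<open>is_coboundary_coboundary\<close>
  and \<open>is_coboundary_unique\<close> below show that it is the antiderivation determined by
  \<open>(d z)(f, g) = - z {f, g}\<close>.
\<close>

definition lie_deriv :: "ham \<Rightarrow> form \<Rightarrow> form"
  where "lie_deriv f \<sigma> = (\<lambda>fs. - (\<Sum>j<length fs. \<sigma> (fs[j := bracket f (fs ! j)])))"

fun coboundary :: "form \<Rightarrow> form"
  where
    "coboundary \<sigma> [] = 0"
  | "coboundary \<sigma> (f # fs) = lie_deriv f \<sigma> fs - coboundary (contract f \<sigma>) fs"

definition is_coboundary :: "(form \<Rightarrow> form) \<Rightarrow> bool"
  where "is_coboundary D \<longleftrightarrow>
    (\<forall>\<sigma>\<in>exterior_algebra. \<forall>\<tau>\<in>exterior_algebra. \<forall>a b.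
        D (a *\<^sub>R \<sigma> + b *\<^sub>R \<tau>) = a *\<^sub>R D \<sigma> + b *\<^sub>R D \<tau>) \<and>
    (\<forall>\<sigma>\<in>exterior_algebra. \<forall>\<tau>\<in>exterior_algebra.
        D (wedge \<sigma> \<tau>) = wedge (D \<sigma>) \<tau> + wedge (grading \<sigma>) (D \<tau>)) \<and>
    (\<forall>l\<ge>2. \<forall>z\<in>dual_homogeneous l. \<forall>fs.
        D (one_form z) fs = (case fs of [f, g] \<Rightarrow> - z (bracket f g) | _ \<Rightarrow> 0))"

lemma contract_add: "contract f (\<alpha> + \<beta>) = contract f \<alpha> + contract f \<beta>"
  and contract_scale: "contract f (c *\<^sub>R \<alpha>) = c *\<^sub>R contract f \<alpha>"
  and contract_diff: "contract f (\<alpha> - \<beta>) = contract f \<alpha> - contract f \<beta>"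
  and contract_minus: "contract f (- \<alpha>) = - contract f \<alpha>"
  and contract_zero: "contract f 0 = 0"
  by (simp_all add: contract_def fun_eq_iff )

lemma grading_add: "grading (\<alpha> + \<beta>) = grading \<alpha> + grading \<beta>"
  and grading_scale: "grading (c *\<^sub>R \<alpha>) = c *\<^sub>R grading \<alpha>"
  and grading_diff: "grading (\<alpha> - \<beta>) = grading \<alpha> - grading \<beta>"
  and grading_minus: "grading (- \<alpha>) = - grading \<alpha>"
  and grading_zero: "grading 0 = 0"
  by (simp_all add: grading_def fun_eq_iff  algebra_simps)

lemma grading_grading: "grading (grading \<alpha>) = \<alpha>"
  by (simp add: grading_def fun_eq_iff flip: power_add mult.assoc)

lemma contract_grading: "contract f (grading \<alpha>) = - grading (contract f \<alpha>)"
  by (simp add: contract_def grading_def fun_eq_iff)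

lemma wedge_add_left: "wedge (\<alpha> + \<alpha>') \<beta> fs = wedge \<alpha> \<beta> fs + wedge \<alpha>' \<beta> fs"
  by (induction fs arbitrary: \<alpha> \<alpha>' \<beta>) (simp_all add: contract_add grading_add algebra_simps)

lemma wedge_add_right: "wedge \<alpha> (\<beta> + \<beta>') fs = wedge \<alpha> \<beta> fs + wedge \<alpha> \<beta>' fs"
  by (induction fs arbitrary: \<alpha> \<beta> \<beta>') (simp_all add: contract_add algebra_simps)

lemma wedge_scale_left: "wedge (c *\<^sub>R \<alpha>) \<beta> fs = c * wedge \<alpha> \<beta> fs"
  by (induction fs arbitrary: \<alpha> \<beta>)
    (simp_all add: contract_scale grading_scale algebra_simps)

lemma wedge_scale_right: "wedge \<alpha> (c *\<^sub>R \<beta>) fs = c * wedge \<alpha> \<beta> fs"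
  by (induction fs arbitrary: \<alpha> \<beta>)
    (simp_all add: contract_scale algebra_simps)

lemma wedge_minus_left: "wedge (- \<alpha>) \<beta> fs = - wedge \<alpha> \<beta> fs"
  using wedge_scale_left[of "-1" \<alpha> \<beta> fs] by simp

lemma wedge_minus_right: "wedge \<alpha> (- \<beta>) fs = - wedge \<alpha> \<beta> fs"
  using wedge_scale_right[of \<alpha> "-1" \<beta> fs] by simp

lemma wedge_diff_left: "wedge (\<alpha> - \<alpha>') \<beta> fs = wedge \<alpha> \<beta> fs - wedge \<alpha>' \<beta> fs"
  using wedge_add_left[of \<alpha> "- \<alpha>'" \<beta> fs] by (simp add: wedge_minus_left)

lemma wedge_diff_right: "wedge \<alpha> (\<beta> - \<beta>') fs = wedge \<alpha> \<beta> fs - wedge \<alpha> \<beta>' fs"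
  using wedge_add_right[of \<alpha> \<beta> "- \<beta>'" fs] by (simp add: wedge_minus_right)

lemma lie_deriv_Nil: "lie_deriv f \<sigma> [] = 0"
  by (simp add: lie_deriv_def)

lemma lie_deriv_Cons:
  "lie_deriv f \<sigma> (g # gs) = - \<sigma> (bracket f g # gs) + lie_deriv f (contract g \<sigma>) gs"
  by (simp add: lie_deriv_def contract_def sum.lessThan_Suc_shift del: sum.lessThan_Suc)

lemma lie_deriv_add: "lie_deriv f (\<alpha> + \<beta>) fs = lie_deriv f \<alpha> fs + lie_deriv f \<beta> fs"
  by (simp add: lie_deriv_def sum.distrib)

lemma contract_lie_deriv:
  "contract g (lie_deriv f \<sigma>) = lie_deriv f (contract g \<sigma>) - contract (bracket f g) \<sigma>"
  by (simp add: fun_eq_iff contract_def lie_deriv_Cons)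

lemma grading_lie_deriv: "grading (lie_deriv f \<sigma>) = lie_deriv f (grading \<sigma>)"
  by (simp add: grading_def lie_deriv_def fun_eq_iff sum_distrib_left)

lemma lie_deriv_wedge:
  "lie_deriv f (wedge \<alpha> \<beta>) fs = wedge (lie_deriv f \<alpha>) \<beta> fs + wedge \<alpha> (lie_deriv f \<beta>) fs"
proof (induction fs arbitrary: \<alpha> \<beta>)
  case Nil
  then show ?case by (simp add: lie_deriv_Nil)
next
  case (Cons g gs)
  have "contract g (wedge \<alpha> \<beta>) = wedge (contract g \<alpha>) \<beta> + wedge (grading \<alpha>) (contract g \<beta>)"
    by (simp add: fun_eq_iff contract_def)
  then show ?case
    by (simp add: lie_deriv_Cons lie_deriv_add Cons contract_lie_deriv grading_lie_deriv
        wedge_diff_left wedge_diff_right)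
qed

lemma coboundary_add: "coboundary (\<alpha> + \<beta>) fs = coboundary \<alpha> fs + coboundary \<beta> fs"
  by (induction fs arbitrary: \<alpha> \<beta>) (simp_all add: lie_deriv_add contract_add)

lemma lie_deriv_scale: "lie_deriv f (c *\<^sub>R \<alpha>) fs = c * lie_deriv f \<alpha> fs"
  by (simp add: lie_deriv_def sum_distrib_left)

lemma coboundary_scale: "coboundary (c *\<^sub>R \<alpha>) fs = c * coboundary \<alpha> fs"
  by (induction fs arbitrary: \<alpha>) (simp_all add: lie_deriv_scale contract_scale algebra_simps)

lemma contract_coboundary:
  "contract f (coboundary \<sigma>) = lie_deriv f \<sigma> - coboundary (contract f \<sigma>)"
  by (simp add: fun_eq_iff contract_def)

lemma coboundary_minus: "coboundary (- \<sigma>) = - coboundary \<sigma>"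
  using coboundary_scale[of "-1" \<sigma>] by (simp add: fun_eq_iff)

lemma coboundary_grading: "coboundary (grading \<sigma>) fs = - grading (coboundary \<sigma>) fs"
proof (induction fs arbitrary: \<sigma>)
  case Nil
  then show ?case by (simp add: grading_def)
next
  case (Cons f fs)
  then show ?case
    by (simp add: contract_grading coboundary_minus flip: grading_lie_deriv)
      (simp add: grading_def algebra_simps)
qed

theorem coboundary_wedge:
  "coboundary (wedge \<alpha> \<beta>) fs = wedge (coboundary \<alpha>) \<beta> fs + wedge (grading \<alpha>) (coboundary \<beta>) fs"
proof (induction fs arbitrary: \<alpha> \<beta>)
  case Nil
  then show ?case by simp
next
  case (Cons f fs)
  have 1: "contract f (wedge \<alpha> \<beta>) = wedge (contract f \<alpha>) \<beta> + wedge (grading \<alpha>) (contract f \<beta>)"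
    by (simp add: fun_eq_iff contract_def)
  have 2: "wedge (coboundary (grading \<alpha>)) \<gamma> gs = - wedge (grading (coboundary \<alpha>)) \<gamma> gs" for \<gamma> gs
  proof -
    have "coboundary (grading \<alpha>) = - grading (coboundary \<alpha>)"
      by (simp add: fun_eq_iff coboundary_grading)
    then show ?thesis by (simp only: wedge_minus_left)
  qed
  show ?case
    by (simp add: 1 2 coboundary_add Cons lie_deriv_wedge contract_coboundary contract_grading
        wedge_diff_left wedge_diff_right wedge_minus_left grading_grading algebra_simps)
qed

lemma contract_unit_form: "contract f unit_form = 0"
  by (simp add: fun_eq_iff contract_def unit_form_def)

lemma grading_unit_form: "grading unit_form = unit_form"
  by (simp add: fun_eq_iff grading_def unit_form_def)

lemma wedge_zero_left: "wedge 0 \<beta> fs = 0"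
  using wedge_scale_left[of 0 0 \<beta> fs] by simp

lemma wedge_zero_right: "wedge \<alpha> 0 fs = 0"
  using wedge_scale_right[of \<alpha> 0 0 fs] by simp

lemma wedge_unit_left: "wedge unit_form \<tau> = \<tau>"
proof
  show "wedge unit_form \<tau> fs = \<tau> fs" for fs
    by (induction fs arbitrary: \<tau>)
      (simp_all add: contract_unit_form grading_unit_form wedge_zero_left, simp_all add: unit_form_def contract_def)
qed

lemma wedge_unit_right: "wedge \<alpha> unit_form = \<alpha>"
proof
  show "wedge \<alpha> unit_form fs = \<alpha> fs" for fs
    by (induction fs arbitrary: \<alpha>)
      (simp_all add: contract_unit_form wedge_zero_right, simp_all add: unit_form_def contract_def)
qed

lemma coboundary_zero: "coboundary 0 = 0"
  using coboundary_scale[of 0 0] by (simp add: fun_eq_iff)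

lemma lie_deriv_unit_form: "lie_deriv f unit_form fs = 0"
  by (cases fs) (simp_all add: lie_deriv_def unit_form_def)

lemma coboundary_unit_form: "coboundary unit_form = 0"
proof
  show "coboundary unit_form fs = 0 fs" for fs
    by (cases fs) (simp_all add: contract_unit_form coboundary_zero lie_deriv_unit_form)
qed

lemma contract_one_form: "contract f (one_form z) = z f *\<^sub>R unit_form"
  by (simp add: fun_eq_iff contract_def one_form_def unit_form_def split: list.split)

theorem coboundary_one_form:
  "coboundary (one_form z) fs = (case fs of [f, g] \<Rightarrow> - z (bracket f g) | _ \<Rightarrow> 0)"
proof (cases fs)
  case (Cons f gs)
  then have "coboundary (one_form z) fs = lie_deriv f (one_form z) gs"
    by (simp add: contract_one_form coboundary_scale coboundary_unit_form)
  also have "\<dots> = (case fs of [f, g] \<Rightarrow> - z (bracket f g) | _ \<Rightarrow> 0)"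
  proof (cases gs)
    case (Cons g hs)
    then show ?thesis
      by (simp add: \<open>fs = f # gs\<close> lie_deriv_Cons contract_one_form lie_deriv_scale
          lie_deriv_unit_form one_form_def split: list.split)
  qed (simp add: Cons lie_deriv_Nil)
  finally show ?thesis .
qed simp

theorem is_coboundary_coboundary: "is_coboundary coboundary"
proof -
  have "coboundary (a *\<^sub>R \<sigma> + b *\<^sub>R \<tau>) = a *\<^sub>R coboundary \<sigma> + b *\<^sub>R coboundary \<tau>" for a b \<sigma> \<tau>
  proof
    show "coboundary (a *\<^sub>R \<sigma> + b *\<^sub>R \<tau>) fs = (a *\<^sub>R coboundary \<sigma> + b *\<^sub>R coboundary \<tau>) fs" for fs
      by (simp add: coboundary_add coboundary_scale)
  qed
  then show ?thesis
    by (simp add: is_coboundary_def coboundary_one_form) (simp add: fun_eq_iff coboundary_wedge)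
qed

lemma wedge_list_Nil: "wedge_list [] = unit_form"
  and wedge_list_Cons: "wedge_list (z # zs) = wedge (one_form z) (wedge_list zs)"
  by (simp_all add: wedge_list_def)

theorem is_coboundary_unique:
  assumes "is_coboundary D" and "\<sigma> \<in> exterior_algebra"
  shows "D \<sigma> = coboundary \<sigma>"
proof -
  define good where "good zs \<longleftrightarrow> (\<forall>z\<in>set zs. \<exists>l\<ge>2. z \<in> dual_homogeneous l)"
    for zs :: "(ham \<Rightarrow> real) list"
  have algebra: "exterior_algebra = span {wedge_list zs | zs. good zs}"
    unfolding exterior_algebra_def good_def ..
  have lin: "D (a *\<^sub>R \<sigma> + b *\<^sub>R \<tau>) = a *\<^sub>R D \<sigma> + b *\<^sub>R D \<tau>"
    if "\<sigma> \<in> exterior_algebra" "\<tau> \<in> exterior_algebra" for \<sigma> \<tau> a b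
    using assms(1) that unfolding is_coboundary_def by blast
  have antider: "D (wedge \<sigma> \<tau>) = wedge (D \<sigma>) \<tau> + wedge (grading \<sigma>) (D \<tau>)"
    if "\<sigma> \<in> exterior_algebra" "\<tau> \<in> exterior_algebra" for \<sigma> \<tau>
    using assms(1) that unfolding is_coboundary_def by blast
  have one: "D (one_form z) = coboundary (one_form z)" if "z \<in> dual_homogeneous l" "2 \<le> l" for z l
  proof
    show "D (one_form z) fs = coboundary (one_form z) fs" for fs
      using assms(1) that unfolding is_coboundary_def coboundary_one_form by blast
  qed
  have mem: "wedge_list zs \<in> exterior_algebra" if "good zs" for zs
    unfolding algebra using that by (intro span_base) blast
  have unit: "D unit_form = 0"
  proof -
    have "unit_form \<in> exterior_algebra"
      using mem[of "[]"] by (simp add: wedge_list_Nil good_def)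
    from antider[OF this this] show ?thesis
      by (simp add: wedge_unit_left wedge_unit_right grading_unit_form)
  qed
  have dec: "D (wedge_list zs) = coboundary (wedge_list zs)" if "good zs" for zs
    using that
  proof (induction zs)
    case Nil
    show ?case by (simp add: wedge_list_Nil unit coboundary_unit_form)
  next
    case (Cons z zs)
    then obtain l where l: "2 \<le> l" "z \<in> dual_homogeneous l" and zs: "good zs"
      by (auto simp: good_def)
    have "one_form z \<in> exterior_algebra"
      using mem[of "[z]"] l by (auto simp: wedge_list_Nil wedge_list_Cons wedge_unit_right good_def)
    then have "D (wedge_list (z # zs)) =
        wedge (D (one_form z)) (wedge_list zs) + wedge (grading (one_form z)) (D (wedge_list zs))"
      using antider mem[OF zs] by (simp add: wedge_list_Cons)
    also have "\<dots> = coboundary (wedge_list (z # zs))"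
      unfolding Cons.IH[OF zs] one[OF l(2,1)] wedge_list_Cons
      by (simp add: fun_eq_iff coboundary_wedge)
    finally show ?case .
  qed
  have "\<sigma> \<in> span {wedge_list zs | zs. good zs}"
    using assms(2) algebra by simp
  then have "\<sigma> \<in> exterior_algebra \<and> D \<sigma> = coboundary \<sigma>"
  proof (induction rule: span_induct_alt)
    case base
    have "0 \<in> exterior_algebra" unfolding algebra by (rule span_zero)
    moreover from this have "D 0 = 0" using lin[of 0 0 0 0] by simp
    ultimately show ?case using coboundary_zero by (simp add: zero_fun_def)
  next
    case (step c x y)
    then obtain zs where zs: "x = wedge_list zs" "good zs" by blast
    then have x: "x \<in> exterior_algebra" "D x = coboundary x" using mem dec by auto
    have "c *\<^sub>R x + y \<in> exterior_algebra"
      using x(1) step unfolding algebra by (intro span_add span_scale) auto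
    moreover have "D (c *\<^sub>R x + y) = c *\<^sub>R D x + D y"
      using lin[OF x(1), of y c 1] step by simp
    moreover have "coboundary (c *\<^sub>R x + y) = c *\<^sub>R coboundary x + coboundary y"
    proof
      show "coboundary (c *\<^sub>R x + y) fs = (c *\<^sub>R coboundary x + coboundary y) fs" for fs
        by (simp add: coboundary_add coboundary_scale)
    qed
    ultimately have "c *\<^sub>R x + y \<in> exterior_algebra \<and> D (c *\<^sub>R x + y) = coboundary (c *\<^sub>R x + y)"
      using x(2) step by simp
    then show ?case by (simp only: plus_fun_def scaleR_fun_def)
  qed
  then show ?thesis ..
qed


section \<open>Relative cochains\<close>

text \<open>
  The momentum map of the linear action of the symplectic group identifies its Lie algebra with
  the homogeneous quadratic polynomials.
\<close>

definition relative_cochains :: "nat \<Rightarrow> nat \<Rightarrow> form set"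
  where "relative_cochains m w =
    {\<sigma> \<in> cochains m w. \<forall>f\<in>homogeneous 2. contract f \<sigma> = 0 \<and> contract f (coboundary \<sigma>) = 0}"

text \<open>
  Relative cochains involve no factor of degree 2, so they vanish for \<open>m > w\<close> and the
  sum over all \<open>m\<close> has finite support.
\<close>

definition euler_number :: "nat \<Rightarrow> int"
  where "euler_number w = Sum_any (\<lambda>m. (- 1) ^ m * int (dim (relative_cochains m w)))"

lemma subspace_relative_cochains: "subspace (relative_cochains m w)"
proof -
  have add: "coboundary (\<sigma> + \<tau>) = coboundary \<sigma> + coboundary \<tau>" for \<sigma> \<tau>
    by (rule ext) (simp add: coboundary_add)
  have scale: "coboundary (c *\<^sub>R \<sigma>) = c *\<^sub>R coboundary \<sigma>" for c \<sigma>
    by (rule ext) (simp add: coboundary_scale)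
  have sub: "subspace (cochains m w)"
    unfolding cochains_def by (rule subspace_span)
  show ?thesis
    unfolding subspace_def relative_cochains_def
    using subspace_0[OF sub] subspace_add[OF sub] subspace_scale[OF sub]
    by (simp only: mem_Collect_eq add scale contract_add contract_scale contract_zero coboundary_zero) simp
qed

text \<open>
  The spaces of cochains are finite-dimensional, so \<^const>\<open>dim\<close> is their true dimension.
\<close>

lemma finite_tdeg: "finite {\<alpha>. tdeg \<alpha> = l}"
proof (rule finite_subset)
  show "{\<alpha>. tdeg \<alpha> = l} \<subseteq> vec_lambda ` (UNIV \<rightarrow>\<^sub>E {..l})"
  proof
    fix \<alpha> :: "nat ^ 4"
    assume "\<alpha> \<in> {\<alpha>. tdeg \<alpha> = l}"
    then have "\<alpha> $ i \<le> l" for i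
      using member_le_sum[of i UNIV "\<lambda>i. \<alpha> $ i"] by (simp add: tdeg_def)
    then have "vec_nth \<alpha> \<in> UNIV \<rightarrow>\<^sub>E {..l}" by auto
    then show "\<alpha> \<in> vec_lambda ` (UNIV \<rightarrow>\<^sub>E {..l})"
      by (metis imageI vec_nth_inverse)
  qed
qed (intro finite_imageI finite_PiE; simp)

definition coord :: "nat ^ 4 \<Rightarrow> ham \<Rightarrow> real"
  where "coord \<alpha> f = Poly_Mapping.lookup (potential f) \<alpha>"

definition monomial :: "nat ^ 4 \<Rightarrow> ham"
  where "monomial \<alpha> = Ham (Poly_Mapping.single \<alpha> 1)"

lemma potential_monomial: "2 \<le> tdeg \<alpha> \<Longrightarrow> potential (monomial \<alpha>) = Poly_Mapping.single \<alpha> 1"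
  unfolding monomial_def by (rule Ham_inverse) simp

lemma potential_sum: "potential (sum g A) = (\<Sum>a\<in>A. potential (g a))"
  by (induction A rule: infinite_finite_induct) (simp_all add: zero_ham.rep_eq plus_ham.rep_eq)

lemma ham_expand: "f = (\<Sum>\<alpha>\<in>Poly_Mapping.keys (potential f). coord \<alpha> f *\<^sub>R monomial \<alpha>)"
proof -
  let ?K = "Poly_Mapping.keys (potential f)"
  have deg: "2 \<le> tdeg \<alpha>" if "\<alpha> \<in> ?K" for \<alpha>
    using potential[of f] that by simp
  have "Poly_Mapping.lookup (potential (\<Sum>\<alpha>\<in>?K. coord \<alpha> f *\<^sub>R monomial \<alpha>)) \<gamma> =
      Poly_Mapping.lookup (potential f) \<gamma>" for \<gamma>
  proof -
    have "Poly_Mapping.lookup (potential (\<Sum>\<alpha>\<in>?K. coord \<alpha> f *\<^sub>R monomial \<alpha>)) \<gamma> =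
        (\<Sum>\<alpha>\<in>?K. if \<alpha> = \<gamma> then coord \<alpha> f else 0)"
      unfolding potential_sum lookup_sum
    proof (rule sum.cong)
      fix \<alpha> assume "\<alpha> \<in> ?K"
      then show "Poly_Mapping.lookup (potential (coord \<alpha> f *\<^sub>R monomial \<alpha>)) \<gamma> =
          (if \<alpha> = \<gamma> then coord \<alpha> f else 0)"
        by (simp add: scaleR_ham.rep_eq potential_monomial deg scaleR_poly_mapping_def lookup_single when_def)
    qed simp
    also have "\<dots> = Poly_Mapping.lookup (potential f) \<gamma>"
      by (auto simp: sum.delta coord_def in_keys_iff)
    finally show ?thesis .
  qed
  then show ?thesis
    by (metis poly_mapping_eqI potential_inject)
qed

lemma sum_form_apply: "(\<Sum>a\<in>A. F a) x = (\<Sum>a\<in>A. F a x)" for F :: "'a \<Rightarrow> 'b \<Rightarrow> real"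
  by (induction A rule: infinite_finite_induct) simp_all

lemma linear_in_span:
  assumes "linear h" "\<And>x. x \<in> B \<Longrightarrow> h x \<in> span C" "x \<in> span B"
  shows "h x \<in> span C"
proof -
  have "h x \<in> span (h ` B)"
    using assms(3) linear_span_image[OF assms(1), of B] by blast
  moreover have "span (h ` B) \<subseteq> span C"
    by (rule span_minimal) (use assms(2) in auto)
  ultimately show ?thesis by blast
qed

lemma dual_homogeneous_subset_span:
  "dual_homogeneous l \<subseteq> span (coord ` {\<alpha>. tdeg \<alpha> = l})"
proof
  fix z assume "z \<in> dual_homogeneous l"
  then have z: "linear z" "\<And>k f. k \<noteq> l \<Longrightarrow> f \<in> homogeneous k \<Longrightarrow> z f = 0"
    by (auto simp: dual_homogeneous_def)
  have "z f = (\<Sum>\<alpha> | tdeg \<alpha> = l. z (monomial \<alpha>) *\<^sub>R coord \<alpha>) f" for f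
  proof -
    let ?K = "Poly_Mapping.keys (potential f)"
    have deg: "2 \<le> tdeg \<alpha>" if "\<alpha> \<in> ?K" for \<alpha>
      using potential[of f] that by simp
    have zero: "z (monomial \<alpha>) = 0" if "\<alpha> \<in> ?K" "tdeg \<alpha> \<noteq> l" for \<alpha>
      using deg[OF that(1)] that(2) by (intro z(2)) (auto simp: homogeneous_def potential_monomial)
    have "z f = (\<Sum>\<alpha>\<in>?K. coord \<alpha> f * z (monomial \<alpha>))"
      using arg_cong[OF ham_expand[of f], of z] by (simp add: linear_sum[OF z(1)] linear_cmul[OF z(1)])
    also have "\<dots> = (\<Sum>\<alpha>\<in>?K \<inter> {\<alpha>. tdeg \<alpha> = l}. coord \<alpha> f * z (monomial \<alpha>))"
      by (rule sum.mono_neutral_right) (auto simp: zero)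
    also have "\<dots> = (\<Sum>\<alpha> | tdeg \<alpha> = l. coord \<alpha> f * z (monomial \<alpha>))"
      by (rule sum.mono_neutral_left) (auto simp: finite_tdeg coord_def in_keys_iff)
    also have "\<dots> = (\<Sum>\<alpha> | tdeg \<alpha> = l. z (monomial \<alpha>) *\<^sub>R coord \<alpha>) f"
      by (simp add: sum_form_apply mult.commute)
    finally show ?thesis .
  qed
  then have "z = (\<Sum>\<alpha> | tdeg \<alpha> = l. z (monomial \<alpha>) *\<^sub>R coord \<alpha>)" by (rule ext)
  moreover have "\<dots> \<in> span (coord ` {\<alpha>. tdeg \<alpha> = l})"
    by (intro span_sum span_scale span_base) auto
  ultimately show "z \<in> span (coord ` {\<alpha>. tdeg \<alpha> = l})" by simp
qed

lemma linear_wedge_left: "linear (\<lambda>\<alpha>. wedge \<alpha> \<beta>)"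
  by (rule linearI) (simp_all add: fun_eq_iff wedge_add_left wedge_scale_left)

lemma linear_wedge_right: "linear (wedge \<alpha>)"
  by (rule linearI) (simp_all add: fun_eq_iff wedge_add_right wedge_scale_right)

lemma linear_one_form: "linear one_form"
  by (rule linearI) (simp_all add: fun_eq_iff one_form_def split: list.split)

lemma wedge_list_in_span:
  assumes "list_all2 (\<lambda>l z. z \<in> dual_homogeneous l) ls zs"
  shows "wedge_list zs \<in> span (wedge_list ` {cs. list_all2 (\<lambda>l c. c \<in> coord ` {\<alpha>. tdeg \<alpha> = l}) ls cs})"
  using assms
proof (induction rule: list_all2_induct)
  case Nil
  show ?case by (rule span_base) simp
next
  case (Cons l ls z zs)
  let ?B = "coord ` {\<alpha>. tdeg \<alpha> = l}"
  let ?C = "{cs. list_all2 (\<lambda>l c. c \<in> coord ` {\<alpha>. tdeg \<alpha> = l}) ls cs}"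
  let ?S = "span (wedge_list ` {cs. list_all2 (\<lambda>l c. c \<in> coord ` {\<alpha>. tdeg \<alpha> = l}) (l # ls) cs})"
  have 1: "wedge (one_form c) (wedge_list cs) \<in> ?S" if "c \<in> ?B" "cs \<in> ?C" for c cs
    unfolding wedge_list_Cons[symmetric] using that by (intro span_base imageI) simp
  have 2: "wedge (one_form c) (wedge_list zs) \<in> ?S" if "c \<in> ?B" for c
  proof (rule linear_in_span[OF linear_wedge_right])
    show "wedge_list zs \<in> span (wedge_list ` ?C)" by (rule Cons.IH)
    show "wedge (one_form c) x \<in> ?S" if "x \<in> wedge_list ` ?C" for x
      using that 1[OF \<open>c \<in> ?B\<close>] by blast
  qed
  have lin: "linear (\<lambda>z. wedge (one_form z) (wedge_list zs))"
    using linear_compose[OF linear_one_form linear_wedge_left] by (simp only: o_def)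
  have "z \<in> span ?B"
    using Cons.hyps dual_homogeneous_subset_span by blast
  then show ?case
    unfolding wedge_list_Cons using linear_in_span[OF lin 2] by blast
qed

lemma length_degree_list: "length (degree_list ks) = sum_list ks"
  by (simp add: degree_list_def length_concat o_def map_nth)

lemma degree_list_bound:
  assumes "l \<in> set (degree_list ks)"
  shows "l \<le> (\<Sum>i<length ks. ks ! i * i) + 2"
proof -
  from assms obtain i where i: "i < length ks" "l = i + 2" "ks ! i \<noteq> 0"
    by (auto simp: degree_list_def split: if_splits)
  then have "i \<le> ks ! i * i" by simp
  also have "\<dots> \<le> (\<Sum>i<length ks. ks ! i * i)"
    using i by (intro member_le_sum) auto
  finally show ?thesis using i by simp
qed

lemma degree_list_coords:
  assumes cs: "list_all2 (\<lambda>l c. c \<in> coord ` {\<alpha>. tdeg \<alpha> = l}) (degree_list ks) cs"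
    and w: "(\<Sum>i<length ks. ks ! i * i) = w"
  shows "set cs \<subseteq> (\<Union>l\<le>w + 2. coord ` {\<alpha>. tdeg \<alpha> = l})"
proof
  fix c assume "c \<in> set cs"
  then obtain i where "i < length cs" "c = cs ! i"
    by (metis in_set_conv_nth)
  then have "c \<in> coord ` {\<alpha>. tdeg \<alpha> = degree_list ks ! i}" "degree_list ks ! i \<in> set (degree_list ks)"
    using list_all2_nthD2[OF cs] list_all2_lengthD[OF cs] by simp_all
  with degree_list_bound w show "c \<in> (\<Union>l\<le>w + 2. coord ` {\<alpha>. tdeg \<alpha> = l})"
    by blast
qed

theorem cochains_finite_dimensional:
  "\<exists>B. finite B \<and> cochains m w \<subseteq> span B"
proof -
  define D where "D = (\<Union>l\<le>w + 2. coord ` {\<alpha>. tdeg \<alpha> = l})"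
  define L where "L = {cs. set cs \<subseteq> D \<and> length cs = m}"
  have "finite D"
    unfolding D_def by (intro finite_UN_I finite_imageI) (simp_all add: finite_tdeg)
  then have "finite (wedge_list ` L)"
    unfolding L_def by (intro finite_imageI finite_lists_length_eq)
  moreover have "cochain_summand ks \<subseteq> span (wedge_list ` L)"
    if ks: "sum_list ks = m" "(\<Sum>i<length ks. ks ! i * i) = w" for ks
  proof -
    let ?C = "{cs. list_all2 (\<lambda>l c. c \<in> coord ` {\<alpha>. tdeg \<alpha> = l}) (degree_list ks) cs}"
    have "cs \<in> L" if cs: "cs \<in> ?C" for cs
    proof -
      have "length cs = m"
        using list_all2_lengthD[of _ "degree_list ks" cs] cs ks(1) length_degree_list[of ks] by simp
      moreover have "set cs \<subseteq> D"
        using degree_list_coords[of ks cs w] cs ks(2) unfolding D_def by simp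
      ultimately show ?thesis unfolding L_def by simp
    qed
    then have "span (wedge_list ` ?C) \<subseteq> span (wedge_list ` L)"
      by (intro span_mono image_mono subsetI)
    then have "wedge_list zs \<in> span (wedge_list ` L)"
      if "list_all2 (\<lambda>l z. z \<in> dual_homogeneous l) (degree_list ks) zs" for zs
      by (rule subsetD) (rule wedge_list_in_span[OF that])
    then show ?thesis
      unfolding cochain_summand_def by (intro span_minimal subspace_span) auto
  qed
  then have "cochains m w \<subseteq> span (wedge_list ` L)"
    unfolding cochains_def by (intro span_minimal subspace_span Union_least) auto
  ultimately show ?thesis by blast
qed

end

theory Submission
  imports Defs
begin

text \<open>
  By Cartan's formula \<open>i_q d = L_q - d i_q\<close>, a cochain is relative exactly if it is killed by
  contraction with every quadratic polynomial \<open>q\<close> and by every Lie derivative \<open>L_q\<close>.  So it is an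
  invariant alternating form whose arguments have degree at least 3.  In weight 4 the degrees of the
  \<open>m\<close> arguments add up to \<open>2m + 4\<close>, whence \<open>3m \<le> 2m + 4\<close>; for \<open>m = 1, 2, 3, 4\<close> the only
  possibilities are the degrees 6, then \<open>3 + 5\<close> and \<open>4 + 4\<close>, then \<open>3 + 3 + 4\<close>, then
  \<open>3 + 3 + 3 + 3\<close>.

  The guiding picture is the value of such a form on powers of linear forms: an invariant function of
  at most four vectors of the symplectic space, hence a function of their pairings \<open>w\<^sub>i\<^sub>j\<close>, since
  generic tuples of at most four vectors with the same pairings are conjugate.

  \<^bold>\<open>Upper bounds.\<close>  The infinitesimal form of this conjugacy: the polynomials \<open>g\<close> with \<open>i_g \<sigma> = 0\<close>
  form a submodule, \<open>x\<^sub>1^l\<close> generates all polynomials of degree \<open>l\<close>, and the stabiliser of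
  \<open>x\<^sub>1^l\<close> still generates all polynomials of degree \<open>k\<close> from \<open>x\<^sub>4^k\<close>.  So an invariant form is
  determined by its values with first arguments \<open>x\<^sub>1^l, x\<^sub>4^k\<close>
  (\<open>contract_mon_zero_from_x1_power\<close>, \<open>contract_mon_zero_from_x4_power\<close>); the remaining
  \<open>sl(2)\<close> in \<open>x\<^sub>2, x\<^sub>3\<close> and the torus restrict the other arguments (\<open>extremal_weight\<close>).  For
  \<open>m \<le> 2\<close> nothing remains, for \<open>m = 3\<close> one number, and for \<open>m = 4\<close> the ten numbers
  \<open>\<sigma>(x\<^sub>1^3, x\<^sub>4^3, x\<^sub>1^i x\<^sub>2^k x\<^sub>4^j, x\<^sub>1^j x\<^sub>3^k x\<^sub>4^i)\<close>, of which alternation leaves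
  three free (\<open>slices_zero\<close>).

  \<^bold>\<open>Lower bounds.\<close>  A multigraph with vertices of degrees \<open>l\<^sub>1, \<dots>, l\<^sub>m\<close> yields an invariant form:
  put the tensor of \<open>l\<^sub>i\<close>-fold derivatives at vertex \<open>i\<close>, contract along the edges with the Poisson
  tensor, and antisymmetrise (\<open>graph_form_relative\<close>).  On powers of linear forms its value is an
  alternating sum of products of pairings, one factor for each edge (\<open>graph_form_linpow\<close>).  For
  cubic graphs on four vertices put \<open>X = w\<^sub>1\<^sub>2 w\<^sub>3\<^sub>4\<close>, \<open>Y = - w\<^sub>1\<^sub>3 w\<^sub>2\<^sub>4\<close>, \<open>Z = w\<^sub>1\<^sub>4 w\<^sub>2\<^sub>3\<close>.
  Exchanging two of the vectors permutes \<open>X, Y, Z\<close> up to a common sign \<open>- 1\<close>, so antisymmetrising a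
  cubic monomial in \<open>X, Y, Z\<close> symmetrises it in these three variables.  The three graphs give, up
  to nonzero constants, \<open>X^3 + Y^3 + Z^3\<close>, the sum of all \<open>X^2 Y\<close>, and \<open>X Y Z\<close>, which are
  independent because \<open>X, Y, Z\<close> take arbitrary values.
\<close>

section \<open>Alternating forms and their weight\<close>

definition alternating :: "nat \<Rightarrow> form \<Rightarrow> bool"
  where "alternating m \<sigma> \<longleftrightarrow>
    (\<forall>fs. length fs \<noteq> m \<longrightarrow> \<sigma> fs = 0) \<and>
    (\<forall>xs ys. linear (\<lambda>f. \<sigma> (xs @ f # ys))) \<and>
    (\<forall>xs f g ys. \<sigma> (xs @ f # g # ys) = - \<sigma> (xs @ g # f # ys))"

text \<open>
  Here the weight of an argument is its degree, so that no truncated subtraction occurs: a cochain of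
  degree \<open>m\<close> and weight \<open>w\<close> has \<open>D = 2m + w\<close>.  The type of \<open>D\<close> is \<open>int\<close> because contraction
  lowers \<open>D\<close> by the degree of the argument, possibly below zero.
\<close>

definition weighted :: "int \<Rightarrow> form \<Rightarrow> bool"
  where "weighted D \<sigma> \<longleftrightarrow>
    (\<forall>fs ls. list_all2 (\<lambda>f l. f \<in> homogeneous l) fs ls \<longrightarrow> int (sum_list ls) \<noteq> D \<longrightarrow> \<sigma> fs = 0)"

lemma alternating_length: "alternating m \<sigma> \<Longrightarrow> length fs \<noteq> m \<Longrightarrow> \<sigma> fs = 0"
  and alternating_linear: "alternating m \<sigma> \<Longrightarrow> linear (\<lambda>f. \<sigma> (xs @ f # ys))"
  and alternating_swap: "alternating m \<sigma> \<Longrightarrow> \<sigma> (xs @ f # g # ys) = - \<sigma> (xs @ g # f # ys)"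
  unfolding alternating_def by blast+

lemma linear_contract_arg:
  assumes "alternating m \<sigma>"
  shows "linear (\<lambda>f. contract f \<sigma>)"
  using alternating_linear[OF assms, of "[]"]
  by (simp add: linear_iff fun_eq_iff contract_def)

lemma alternating_contract:
  assumes "alternating (Suc m) \<sigma>"
  shows "alternating m (contract f \<sigma>)"
  unfolding alternating_def contract_def
proof (intro conjI allI impI)
  show "\<sigma> (f # fs) = 0" if "length fs \<noteq> m" for fs
    using alternating_length[OF assms, of "f # fs"] that by simp
  show "linear (\<lambda>g. \<sigma> (f # xs @ g # ys))" for xs ys
    using alternating_linear[OF assms, of "f # xs" ys] by simp
  show "\<sigma> (f # xs @ g # h # ys) = - \<sigma> (f # xs @ h # g # ys)" for xs g h ys
    using alternating_swap[OF assms, of "f # xs" g h ys] by simp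
qed

lemma contract_contract:
  assumes "alternating m \<sigma>"
  shows "contract f (contract g \<sigma>) = - contract g (contract f \<sigma>)"
  using alternating_swap[OF assms, of "[]" g f] by (simp add: contract_def fun_eq_iff)

lemma weighted_contract:
  assumes "weighted D \<sigma>" "f \<in> homogeneous l"
  shows "weighted (D - int l) (contract f \<sigma>)"
  unfolding weighted_def contract_def
proof (intro allI impI)
  fix fs ls assume "list_all2 (\<lambda>f l. f \<in> homogeneous l) fs ls" "int (sum_list ls) \<noteq> D - int l"
  then have "list_all2 (\<lambda>f l. f \<in> homogeneous l) (f # fs) (l # ls)" "int (sum_list (l # ls)) \<noteq> D"
    using assms(2) by auto
  then show "\<sigma> (f # fs) = 0" using assms(1) unfolding weighted_def by blast
qed

lemma alternating_scale:
  assumes "alternating m \<sigma>"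
  shows "alternating m (c *\<^sub>R \<sigma>)"
  unfolding alternating_def
proof (intro conjI allI impI)
  show "(c *\<^sub>R \<sigma>) fs = 0" if "length fs \<noteq> m" for fs
    using alternating_length[OF assms that] by simp
  show "linear (\<lambda>f. (c *\<^sub>R \<sigma>) (xs @ f # ys))" for xs ys
    using linear_compose_scale_right[OF alternating_linear[OF assms, of xs ys], of c] by simp
  show "(c *\<^sub>R \<sigma>) (xs @ f # g # ys) = - (c *\<^sub>R \<sigma>) (xs @ g # f # ys)" for xs f g ys
    using alternating_swap[OF assms, of xs f g ys] by simp
qed

lemma alternating_add:
  assumes "alternating m \<sigma>" "alternating m \<tau>"
  shows "alternating m (\<sigma> + \<tau>)"
  unfolding alternating_def
proof (intro conjI allI impI)
  show "(\<sigma> + \<tau>) fs = 0" if "length fs \<noteq> m" for fs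
    using assms[THEN alternating_length, OF that] by simp
  show "linear (\<lambda>f. (\<sigma> + \<tau>) (xs @ f # ys))" for xs ys
    using linear_compose_add[OF assms[THEN alternating_linear]] by simp
  show "(\<sigma> + \<tau>) (xs @ f # g # ys) = - (\<sigma> + \<tau>) (xs @ g # f # ys)" for xs f g ys
    using assms[THEN alternating_swap, of xs f g ys] by simp
qed

lemma alternating_zero: "alternating m 0"
  by (simp add: alternating_def linear_zero)

lemma subspace_alternating_weighted: "subspace {\<sigma>. alternating m \<sigma> \<and> weighted D \<sigma>}"
proof -
  have "weighted D (c *\<^sub>R \<sigma>)" if "weighted D \<sigma>" for c \<sigma>
    using that by (simp add: weighted_def)
  moreover have "weighted D (\<sigma> + \<tau>)" if "weighted D \<sigma>" "weighted D \<tau>" for \<sigma> \<tau>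
    using that by (simp add: weighted_def)
  moreover have "weighted D 0"
    by (simp add: weighted_def)
  ultimately show ?thesis
    by (simp add: subspace_def alternating_scale alternating_add alternating_zero)
qed

lemma wedge_one_form_Cons:
  "wedge (one_form z) \<beta> (f # fs) = z f * \<beta> fs - wedge (one_form z) (contract f \<beta>) fs"
proof -
  have g: "grading (one_form z) = - one_form z"
    by (simp add: fun_eq_iff grading_def one_form_def split: list.split)
  show ?thesis
    by (simp add: contract_one_form wedge_scale_left wedge_unit_left g wedge_minus_left)
qed

\<comment> \<open>From here on exterior products with a one-form are expanded by the previous lemma only.\<close>
declare wedge.simps(2) [simp del]

lemma wedge_one_form_length:
  assumes "\<And>gs. length gs \<noteq> m \<Longrightarrow> \<beta> gs = 0" "length fs \<noteq> Suc m"
  shows "wedge (one_form z) \<beta> fs = 0"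
  using assms
proof (induction fs arbitrary: \<beta> m)
  case Nil
  then show ?case by (simp add: one_form_def)
next
  case (Cons f fs)
  have "wedge (one_form z) (contract f \<beta>) fs = 0"
  proof (cases m)
    case 0
    then have "contract f \<beta> = 0" using Cons.prems(1) by (simp add: contract_def fun_eq_iff)
    then show ?thesis by (simp add: wedge_zero_right)
  next
    case (Suc k)
    show ?thesis by (rule Cons.IH[of k]) (use Cons.prems Suc in \<open>auto simp: contract_def\<close>)
  qed
  then show ?case using Cons.prems by (simp add: wedge_one_form_Cons)
qed

lemma wedge_one_form_linear:
  assumes z: "linear z" and \<beta>: "\<And>xs ys. linear (\<lambda>f. \<beta> (xs @ f # ys))"
  shows "linear (\<lambda>f. wedge (one_form z) \<beta> (xs @ f # ys))"
  using \<beta>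
proof (induction xs arbitrary: \<beta>)
  case Nil
  have c: "contract (f + g) \<beta> = contract f \<beta> + contract g \<beta>"
    "contract (r *\<^sub>R f) \<beta> = r *\<^sub>R contract f \<beta>" for f g r
    using Nil[of "[]"] by (simp_all add: linear_iff fun_eq_iff contract_def)
  show ?case
    by (rule linearI) (simp_all add: wedge_one_form_Cons c wedge_add_right wedge_scale_right
        linear_add[OF z] linear_cmul[OF z] algebra_simps)
next
  case (Cons x xs)
  have "linear (\<lambda>f. wedge (one_form z) (contract x \<beta>) (xs @ f # ys))"
    by (rule Cons.IH) (use Cons.prems[of "x # _"] in \<open>simp add: contract_def\<close>)
  moreover have "linear (\<lambda>f. z x * \<beta> (xs @ f # ys))"
    using linear_compose_scale_right[OF Cons.prems, of "z x"] by simp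
  ultimately show ?case
    unfolding append_Cons wedge_one_form_Cons by (rule linear_compose_sub[rotated])
qed

lemma wedge_one_form_swap:
  assumes "\<And>xs f g ys. \<beta> (xs @ f # g # ys) = - \<beta> (xs @ g # f # ys)"
  shows "wedge (one_form z) \<beta> (xs @ f # g # ys) = - wedge (one_form z) \<beta> (xs @ g # f # ys)"
  using assms
proof (induction xs arbitrary: \<beta>)
  case Nil
  have "contract g (contract f \<beta>) = - contract f (contract g \<beta>)"
    using Nil[of "[]" f g] by (simp add: contract_def fun_eq_iff)
  then show ?case by (simp add: wedge_one_form_Cons contract_def wedge_minus_right)
next
  case (Cons x xs)
  have "contract x \<beta> (us @ a # b # vs) = - contract x \<beta> (us @ b # a # vs)" for us a b vs
    using Cons.prems[of "x # us" a b vs] by (simp add: contract_def)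
  then have "wedge (one_form z) (contract x \<beta>) (xs @ f # g # ys)
    = - wedge (one_form z) (contract x \<beta>) (xs @ g # f # ys)"
    by (rule Cons.IH)
  then show ?case using Cons.prems[of xs f g ys] by (simp add: wedge_one_form_Cons)
qed

lemma alternating_wedge_one_form:
  "linear z \<Longrightarrow> alternating m \<beta> \<Longrightarrow> alternating (Suc m) (wedge (one_form z) \<beta>)"
  unfolding alternating_def
  using wedge_one_form_length[of m \<beta>] wedge_one_form_linear[of z \<beta>] wedge_one_form_swap[of \<beta>]
  by blast

lemma weighted_wedge_one_form:
  assumes z: "z \<in> dual_homogeneous l" and "weighted D \<beta>"
  shows "weighted (int l + D) (wedge (one_form z) \<beta>)"
  unfolding weighted_def
proof (intro allI impI)
  fix fs ls assume "list_all2 (\<lambda>f l. f \<in> homogeneous l) fs ls" "int (sum_list ls) \<noteq> int l + D"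
  then show "wedge (one_form z) \<beta> fs = 0"
    using assms(2)
  proof (induction fs ls arbitrary: \<beta> D rule: list_all2_induct)
    case Nil
    show ?case by (simp add: one_form_def)
  next
    case (Cons f fs k ks)
    have "wedge (one_form z) (contract f \<beta>) fs = 0"
      by (rule Cons.IH[of "D - int k"]) (use Cons weighted_contract in auto)
    moreover have "z f * \<beta> fs = 0"
    proof (cases "k = l")
      case True
      then show ?thesis using Cons by (auto simp: weighted_def)
    next
      case False
      then show ?thesis using z Cons.hyps by (auto simp: dual_homogeneous_def)
    qed
    ultimately show ?case by (simp add: wedge_one_form_Cons)
  qed
qed

lemma sum_list_concat_map: "sum_list (concat (map f xs)) = (\<Sum>x\<leftarrow>xs. sum_list (f x))"
  by (induction xs) simp_all

lemma sum_degree_list: "sum_list (degree_list ks) = 2 * sum_list ks + (\<Sum>i<length ks. ks ! i * i)"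
proof -
  have "sum_list (degree_list ks) = (\<Sum>i<length ks. ks ! i * (i + 2))"
    by (simp add: degree_list_def sum_list_concat_map o_def sum_list_replicate interv_sum_list_conv_sum_set_nat atLeast0LessThan)
  moreover have "sum_list ks = (\<Sum>i<length ks. ks ! i)"
    by (simp add: sum_list_sum_nth atLeast0LessThan)
  ultimately show ?thesis by (simp add: add_mult_distrib2 sum.distrib flip: sum_distrib_right)
qed

lemma wedge_list_alternating_weighted:
  assumes "list_all2 (\<lambda>l z. z \<in> dual_homogeneous l) ls zs"
  shows "alternating (length ls) (wedge_list zs) \<and> weighted (int (sum_list ls)) (wedge_list zs)"
  using assms
proof (induction rule: list_all2_induct)
  case Nil
  have "linear (\<lambda>f. unit_form (xs @ f # ys))" for xs ys
    by (simp add: unit_form_def linear_zero)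
  then show ?case
    by (auto simp: wedge_list_Nil alternating_def weighted_def unit_form_def)
next
  case (Cons l ls z zs)
  then have "linear z" by (simp add: dual_homogeneous_def)
  with Cons show ?case
    by (simp add: wedge_list_Cons alternating_wedge_one_form weighted_wedge_one_form)
qed

text \<open>
  The upper bounds see cochains only through these two properties.
\<close>

lemma cochains_alternating_weighted:
  assumes "\<sigma> \<in> cochains m w"
  shows "alternating m \<sigma>" "weighted (2 * int m + int w) \<sigma>"
proof -
  have "cochain_summand ks \<subseteq> {\<sigma>. alternating m \<sigma> \<and> weighted (2 * int m + int w) \<sigma>}"
    if "sum_list ks = m" "(\<Sum>i<length ks. ks ! i * i) = w" for ks
    unfolding cochain_summand_def
  proof (intro span_minimal subspace_alternating_weighted subsetI)
    fix \<sigma> assume "\<sigma> \<in> {wedge_list zs | zs. list_all2 (\<lambda>l z. z \<in> dual_homogeneous l) (degree_list ks) zs}"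
    then obtain zs where "\<sigma> = wedge_list zs" "list_all2 (\<lambda>l z. z \<in> dual_homogeneous l) (degree_list ks) zs"
      by blast
    then show "\<sigma> \<in> {\<sigma>. alternating m \<sigma> \<and> weighted (2 * int m + int w) \<sigma>}"
      using wedge_list_alternating_weighted[of "degree_list ks" zs] that
      by (simp add: length_degree_list sum_degree_list)
  qed
  then have "cochains m w \<subseteq> {\<sigma>. alternating m \<sigma> \<and> weighted (2 * int m + int w) \<sigma>}"
    unfolding cochains_def by (intro span_minimal subspace_alternating_weighted Union_least) auto
  then show "alternating m \<sigma>" "weighted (2 * int m + int w) \<sigma>"
    using assms by auto
qed

text \<open>
  The part of the definition of relative cochains that survives contraction with an arbitrary
  polynomial.  Invariance does not: it survives only under the stabiliser of that polynomial.
\<close>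

definition horizontal :: "nat \<Rightarrow> int \<Rightarrow> form \<Rightarrow> bool"
  where "horizontal m D \<sigma> \<longleftrightarrow>
    alternating m \<sigma> \<and> weighted D \<sigma> \<and> (\<forall>q\<in>homogeneous 2. contract q \<sigma> = 0)"

lemma relative_cochains_horizontal:
  assumes "\<sigma> \<in> relative_cochains m w"
  shows "horizontal m (2 * int m + int w) \<sigma>" "q \<in> homogeneous 2 \<Longrightarrow> lie_deriv q \<sigma> = 0"
proof -
  show "horizontal m (2 * int m + int w) \<sigma>"
    using assms cochains_alternating_weighted unfolding horizontal_def relative_cochains_def by blast
  assume "q \<in> homogeneous 2"
  then have "contract q \<sigma> = 0" "contract q (coboundary \<sigma>) = 0"
    using assms by (auto simp: relative_cochains_def)
  then show "lie_deriv q \<sigma> = 0"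
    by (simp add: contract_coboundary coboundary_zero)
qed

lemma horizontal_contract:
  assumes "horizontal (Suc m) D \<sigma>" "f \<in> homogeneous l"
  shows "horizontal m (D - int l) (contract f \<sigma>)"
proof -
  have "contract q (contract f \<sigma>) = 0" if "q \<in> homogeneous 2" for q
    using assms(1) that contract_contract[of "Suc m" \<sigma> q f]
    by (simp add: horizontal_def contract_zero)
  then show ?thesis
    using assms alternating_contract weighted_contract unfolding horizontal_def by blast
qed

section \<open>Monomials and the action of quadratic polynomials\<close>

definition expo :: "nat \<Rightarrow> nat \<Rightarrow> nat \<Rightarrow> nat \<Rightarrow> nat ^ 4"
  where "expo a b c d = (\<chi> i. if i = 1 then a else if i = 2 then b else if i = 3 then c else d)"

lemma expo_nth [simp]:
  "expo a b c d $ 1 = a" "expo a b c d $ 2 = b" "expo a b c d $ 3 = c" "expo a b c d $ 4 = d"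
  by (simp_all add: expo_def)

definition mon :: "nat \<Rightarrow> nat \<Rightarrow> nat \<Rightarrow> nat \<Rightarrow> ham"
  where "mon a b c d = monomial (expo a b c d)"

lemma tdeg_expo: "tdeg (expo a b c d) = a + b + c + d"
  by (simp add: tdeg_def sum_4)

lemma expo_eta: "(\<alpha> :: nat ^ 4) = expo (\<alpha> $ 1) (\<alpha> $ 2) (\<alpha> $ 3) (\<alpha> $ 4)"
  by (simp add: vec_eq_iff forall_4)

lemma mon_homogeneous: "2 \<le> a + b + c + d \<Longrightarrow> a + b + c + d = l \<Longrightarrow> mon a b c d \<in> homogeneous l"
  by (simp add: mon_def homogeneous_def potential_monomial tdeg_expo)

lemma span_mon: "span {mon a b c d | a b c d. 2 \<le> a + b + c + d} = UNIV"
proof -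
  have "f \<in> span {mon a b c d | a b c d. 2 \<le> a + b + c + d}" for f
  proof (subst ham_expand, intro span_sum span_scale span_base)
    fix \<alpha> assume "\<alpha> \<in> Poly_Mapping.keys (potential f)"
    then have "2 \<le> tdeg \<alpha>" using potential[of f] by simp
    then show "monomial \<alpha> \<in> {mon a b c d | a b c d. 2 \<le> a + b + c + d}"
      using expo_eta[of \<alpha>] tdeg_expo unfolding mon_def by (smt (verit) mem_Collect_eq)
  qed
  then show ?thesis by blast
qed

text \<open>
  Vanishing of forms is proved one argument at a time: by multilinearity it suffices to contract with
  monomials, which leads to forms of lower degree.
\<close>

lemma form_zero_if_contract_mon:
  assumes "alternating m \<sigma>" "0 < m"
    and "\<And>a b c d. 2 \<le> a + b + c + d \<Longrightarrow> contract (mon a b c d) \<sigma> = 0"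
  shows "\<sigma> = 0"
proof
  fix fs
  have z: "contract f \<sigma> = 0" for f
    by (rule linear_eq_0_on_span[OF linear_contract_arg[OF assms(1)],
          of "{mon a b c d | a b c d. 2 \<le> a + b + c + d}"]) (use assms(3) span_mon in auto)
  show "\<sigma> fs = 0 fs"
  proof (cases fs)
    case Nil
    then show ?thesis using alternating_length[OF assms(1)] assms(2) by simp
  next
    case (Cons f gs)
    then show ?thesis using fun_cong[OF z[of f], of gs] by (simp add: contract_def)
  qed
qed

lemma horizontal_0_form_zero:
  assumes "horizontal 0 D \<sigma>" "D \<noteq> 0"
  shows "\<sigma> = 0"
proof
  have "\<sigma> [] = 0"
    using assms unfolding horizontal_def weighted_def by (metis list_all2_Nil sum_list.Nil of_nat_0)
  moreover have "\<sigma> fs = 0" if "fs \<noteq> []" for fs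
    using assms(1) that alternating_length[of 0 \<sigma> fs] by (simp add: horizontal_def)
  ultimately show "\<sigma> fs = 0 fs" for fs by (cases "fs = []") simp_all
qed

text \<open>
  Each argument of a horizontal form has degree at least 3, so \<open>m\<close> of them have total degree at
  least \<open>3m\<close>.
\<close>

lemma horizontal_zero_if_weight_small:
  assumes "horizontal m D \<sigma>" "D < 3 * int m"
  shows "\<sigma> = 0"
  using assms
proof (induction m arbitrary: D \<sigma>)
  case 0
  then show ?case by (intro horizontal_0_form_zero[of D]) auto
next
  case (Suc m)
  show ?case
  proof (rule form_zero_if_contract_mon[of "Suc m"])
    show "alternating (Suc m) \<sigma>" using Suc.prems by (simp add: horizontal_def)
    fix a b c d :: nat assume l: "2 \<le> a + b + c + d"
    show "contract (mon a b c d) \<sigma> = 0"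
    proof (cases "a + b + c + d = 2")
      case True
      then show ?thesis using Suc.prems(1) mon_homogeneous[OF l] by (auto simp: horizontal_def)
    next
      case False
      show ?thesis
        by (rule Suc.IH[OF horizontal_contract[OF Suc.prems(1) mon_homogeneous[OF l refl]]])
          (use Suc.prems(2) l False in simp)
    qed
  qed simp
qed

text \<open>
  The bound on the degree \<open>l\<close> of the first argument reserves degree 3 for each of the remaining
  \<open>m\<close> arguments; if there are none, \<open>l\<close> must exhaust the weight.
\<close>

lemma horizontal_zero_if_contract_mon:
  assumes "horizontal (Suc m) D \<sigma>"
    and "\<And>a b c d. 3 \<le> a + b + c + d \<Longrightarrow> 3 * int m + int (a + b + c + d) \<le> D \<Longrightarrow>
      m = 0 \<longrightarrow> int (a + b + c + d) = D \<Longrightarrow> contract (mon a b c d) \<sigma> = 0"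
  shows "\<sigma> = 0"
proof (rule form_zero_if_contract_mon[of "Suc m"])
  show "alternating (Suc m) \<sigma>" using assms by (simp add: horizontal_def)
  fix a b c d :: nat assume l: "2 \<le> a + b + c + d"
  have h: "horizontal m (D - int (a + b + c + d)) (contract (mon a b c d) \<sigma>)"
    using horizontal_contract[OF assms(1) mon_homogeneous[OF l refl]] .
  consider "a + b + c + d = 2" | "3 \<le> a + b + c + d" "3 * int m + int (a + b + c + d) > D"
    | "m = 0" "int (a + b + c + d) \<noteq> D"
    | "3 \<le> a + b + c + d" "3 * int m + int (a + b + c + d) \<le> D" "m = 0 \<longrightarrow> int (a + b + c + d) = D"
    using l by linarith
  then show "contract (mon a b c d) \<sigma> = 0"
  proof cases
    case 1
    then show ?thesis using assms(1) mon_homogeneous[OF l] by (auto simp: horizontal_def)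
  next
    case 2
    then show ?thesis using horizontal_zero_if_weight_small[OF h] by simp
  next
    case 3
    then show ?thesis using h horizontal_0_form_zero[of "D - int (a + b + c + d)"] by simp
  next
    case 4
    then show ?thesis using assms(2) by blast
  qed
qed simp


lemma pd_single: "pd i (Poly_Mapping.single \<alpha> c) = Poly_Mapping.single (\<alpha> - axis i 1) (real (\<alpha> $ i) * c)"
  by (simp add: pd_def)

lemma potential_mon: "2 \<le> a + b + c + d \<Longrightarrow> potential (mon a b c d) = Poly_Mapping.single (expo a b c d) 1"
  by (simp add: mon_def potential_monomial tdeg_expo)

lemma scaleR_single: "r *\<^sub>R Poly_Mapping.single \<alpha> c = Poly_Mapping.single \<alpha> (r * c)"
  by (rule poly_mapping_eqI) (simp add: scaleR_poly_mapping_def lookup_single when_def)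

lemma expo_shift:
  "expo a b c d - axis 1 1 = (expo (a - 1) b c d)"
  "expo a b c d - axis 2 1 = (expo a (b - 1) c d)"
  "expo a b c d - axis 3 1 = (expo a b (c - 1) d)"
  "expo a b c d - axis 4 1 = (expo a b c (d - 1))"
  "expo a b c d + expo a' b' c' d' = (expo (a + a') (b + b') (c + c') (d + d'))"
  by (simp_all add: vec_eq_iff forall_4 axis_def)

lemma bracket_mon_eqI:
  assumes "2 \<le> a + b + c + d" "2 \<le> a' + b' + c' + d'"
    and "poisson (Poly_Mapping.single (expo a' b' c' d') 1) (Poly_Mapping.single (expo a b c d) 1)
      = potential h"
  shows "bracket (mon a' b' c' d') (mon a b c d) = h"
  using assms by (metis bracket.rep_eq potential_inject potential_mon)

text \<open>
  The quadratic monomials act as the root vectors and the torus of \<open>sp(4)\<close>.  If an exponent is 0 then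
  the truncated subtraction on the right is harmless because its coefficient vanishes.
\<close>

lemma bracket_mon:
  assumes "2 \<le> a + b + c + d"
  shows "bracket (mon 2 0 0 0) (mon a b c d) = (2 * real d) *\<^sub>R mon (a + 1) b c (d - 1)"
    and "bracket (mon 0 2 0 0) (mon a b c d) = (2 * real c) *\<^sub>R mon a (b + 1) (c - 1) d"
    and "bracket (mon 0 0 2 0) (mon a b c d) = (- 2 * real b) *\<^sub>R mon a (b - 1) (c + 1) d"
    and "bracket (mon 0 0 0 2) (mon a b c d) = (- 2 * real a) *\<^sub>R mon (a - 1) b c (d + 1)"
    and "bracket (mon 1 1 0 0) (mon a b c d) = real d *\<^sub>R mon a (b + 1) c (d - 1) + real c *\<^sub>R mon (a + 1) b (c - 1) d"
    and "bracket (mon 1 0 1 0) (mon a b c d) = real d *\<^sub>R mon a b (c + 1) (d - 1) - real b *\<^sub>R mon (a + 1) (b - 1) c d"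
    and "bracket (mon 0 1 0 1) (mon a b c d) = real c *\<^sub>R mon a b (c - 1) (d + 1) - real a *\<^sub>R mon (a - 1) (b + 1) c d"
    and "bracket (mon 0 0 1 1) (mon a b c d) = (- real b) *\<^sub>R mon a (b - 1) c (d + 1) - real a *\<^sub>R mon (a - 1) b (c + 1) d"
    and "bracket (mon 1 0 0 1) (mon a b c d) = (real d - real a) *\<^sub>R mon a b c d"
    and "bracket (mon 0 1 1 0) (mon a b c d) = (real c - real b) *\<^sub>R mon a b c d"
proof -
  have p: "potential (k *\<^sub>R mon a' b' c' d') = Poly_Mapping.single (expo a' b' c' d') k"
    if "k = 0 \<or> 2 \<le> a' + b' + c' + d'" for k a' b' c' d'
    using that by (auto simp: scaleR_ham.rep_eq potential_mon scaleR_single zero_ham.rep_eq)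
  note s = poisson_def pd_single expo_shift expo_shift[unfolded One_nat_def] Poly_Mapping.mult_single plus_ham.rep_eq minus_ham.rep_eq uminus_ham.rep_eq zero_ham.rep_eq
  show "bracket (mon 2 0 0 0) (mon a b c d) = (2 * real d) *\<^sub>R mon (a + 1) b c (d - 1)"
    by (rule bracket_mon_eqI[OF assms], simp)
      (insert assms, cases a; cases b; cases c; cases d; simp add: s p)
  show "bracket (mon 0 2 0 0) (mon a b c d) = (2 * real c) *\<^sub>R mon a (b + 1) (c - 1) d"
    by (rule bracket_mon_eqI[OF assms], simp)
      (insert assms, cases a; cases b; cases c; cases d; simp add: s p)
  show "bracket (mon 0 0 2 0) (mon a b c d) = (- 2 * real b) *\<^sub>R mon a (b - 1) (c + 1) d"
    by (rule bracket_mon_eqI[OF assms], simp)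
      (insert assms, cases a; cases b; cases c; cases d; simp add: s p flip: single_uminus)
  show "bracket (mon 0 0 0 2) (mon a b c d) = (- 2 * real a) *\<^sub>R mon (a - 1) b c (d + 1)"
    by (rule bracket_mon_eqI[OF assms], simp)
      (insert assms, cases a; cases b; cases c; cases d; simp add: s p flip: single_uminus)
  show "bracket (mon 1 1 0 0) (mon a b c d) = real d *\<^sub>R mon a (b + 1) c (d - 1) + real c *\<^sub>R mon (a + 1) b (c - 1) d"
    by (rule bracket_mon_eqI[OF assms], simp)
      (insert assms, cases a; cases b; cases c; cases d; simp add: s p)
  show "bracket (mon 1 0 1 0) (mon a b c d) = real d *\<^sub>R mon a b (c + 1) (d - 1) - real b *\<^sub>R mon (a + 1) (b - 1) c d"
    by (rule bracket_mon_eqI[OF assms], simp)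
      (insert assms, cases a; cases b; cases c; cases d; simp add: s p)
  show "bracket (mon 0 1 0 1) (mon a b c d) = real c *\<^sub>R mon a b (c - 1) (d + 1) - real a *\<^sub>R mon (a - 1) (b + 1) c d"
    by (rule bracket_mon_eqI[OF assms], simp)
      (insert assms, cases a; cases b; cases c; cases d; simp add: s p)
  show "bracket (mon 0 0 1 1) (mon a b c d) = (- real b) *\<^sub>R mon a (b - 1) c (d + 1) - real a *\<^sub>R mon (a - 1) b (c + 1) d"
    by (rule bracket_mon_eqI[OF assms], simp)
      (insert assms, cases a; cases b; cases c; cases d; simp add: s p flip: single_uminus)
  show "bracket (mon 1 0 0 1) (mon a b c d) = (real d - real a) *\<^sub>R mon a b c d"
    by (rule bracket_mon_eqI[OF assms], simp)
      (insert assms, cases a; cases b; cases c; cases d; simp add: s p flip: single_diff single_uminus)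
  show "bracket (mon 0 1 1 0) (mon a b c d) = (real c - real b) *\<^sub>R mon a b c d"
    by (rule bracket_mon_eqI[OF assms], simp)
      (insert assms, cases a; cases b; cases c; cases d; simp add: s p flip: single_diff single_uminus)
qed


\<comment> \<open>The second copy matches goals in which the simplifier has turned the exponent \<open>1\<close> into \<open>Suc 0\<close>.\<close>
lemmas bracket_mons = bracket_mon bracket_mon[unfolded One_nat_def]

definition invariant :: "form \<Rightarrow> bool"
  where "invariant \<sigma> \<longleftrightarrow> (\<forall>q\<in>homogeneous 2. lie_deriv q \<sigma> = 0)"

text \<open>
  Contraction with an eigenvector of \<open>{q, -}\<close> adds the eigenvalues.  With eigenvalue 0 this passes
  invariance on to the stabiliser of the argument; for \<open>q\<close> in the torus it keeps track of weights.
\<close>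

lemma lie_deriv_contract_eigen:
  assumes "alternating m \<sigma>" "lie_deriv q \<sigma> = c *\<^sub>R \<sigma>" "bracket q x = d *\<^sub>R x"
  shows "lie_deriv q (contract x \<sigma>) = (c + d) *\<^sub>R contract x \<sigma>"
proof -
  have "contract x (lie_deriv q \<sigma>) = lie_deriv q (contract x \<sigma>) - contract (bracket q x) \<sigma>"
    by (rule contract_lie_deriv)
  then have "lie_deriv q (contract x \<sigma>) = c *\<^sub>R contract x \<sigma> + contract (d *\<^sub>R x) \<sigma>"
    by (simp add: assms(2,3) contract_scale algebra_simps)
  also have "contract (d *\<^sub>R x) \<sigma> = d *\<^sub>R contract x \<sigma>"
    by (rule linear_cmul[OF linear_contract_arg[OF assms(1)]])
  finally show ?thesis by (simp only: scaleR_add_left)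
qed

lemma lie_deriv_contract_stable:
  assumes "alternating m \<sigma>" "lie_deriv q \<sigma> = 0" "bracket q x = 0"
  shows "lie_deriv q (contract x \<sigma>) = 0"
  using lie_deriv_contract_eigen[OF assms(1), of q 0 x 0] assms(2,3) by (simp add: zero_fun_def)

text \<open>
  The elements \<open>g\<close> with \<open>i_g \<tau> = 0\<close> are stable under \<open>{q, -}\<close> whenever \<open>\<tau>\<close> is invariant
  under \<open>q\<close>.  This is how a known zero propagates.
\<close>

lemma contract_bracket_eq_0:
  assumes "lie_deriv q \<tau> = 0" "contract g \<tau> = 0"
  shows "contract (bracket q g) \<tau> = 0"
proof -
  have "lie_deriv q 0 = 0"
    by (simp add: fun_eq_iff lie_deriv_def)
  then show ?thesis
    using contract_lie_deriv[of g q \<tau>] assms by (simp add: contract_zero)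
qed

lemma contract_eq_0_iff:
  assumes "alternating (Suc 0) \<tau>"
  shows "contract g \<tau> = 0 \<longleftrightarrow> \<tau> [g] = 0"
proof
  assume "\<tau> [g] = 0"
  show "contract g \<tau> = 0"
  proof
    show "contract g \<tau> fs = 0 fs" for fs
      using \<open>\<tau> [g] = 0\<close> alternating_length[OF assms, of "g # fs"]
      by (cases fs) (simp_all add: contract_def)
  qed
next
  assume "contract g \<tau> = 0"
  then have "contract g \<tau> [] = 0" by simp
  then show "\<tau> [g] = 0" by (simp add: contract_def)
qed

text \<open>
  A Lie derivative acts by zero on forms of degree 0, that is, on numbers, so the weight of the only
  argument has to cancel the weight of the one-form.
\<close>

lemma contract_zero_if_weight_nonzero:
  assumes "alternating (Suc 0) \<tau>" "lie_deriv q \<tau> = c *\<^sub>R \<tau>" "bracket q g = d *\<^sub>R g" "c + d \<noteq> 0"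
  shows "contract g \<tau> = 0"
proof -
  have "0 = (c + d) * \<tau> [g]"
    using fun_cong[OF lie_deriv_contract_eigen[OF assms(1-3)], of "[]"]
    by (simp add: lie_deriv_Nil contract_def)
  then show ?thesis using assms(4) contract_eq_0_iff[OF assms(1)] by simp
qed

section \<open>Reducing the arguments to a normal form\<close>

text \<open>
  The operators \<open>x\<^sub>4 \<partial>\<^sub>1\<close>, \<open>x\<^sub>4 \<partial>\<^sub>2 + x\<^sub>3 \<partial>\<^sub>1\<close> and \<open>x\<^sub>4 \<partial>\<^sub>3 - x\<^sub>2 \<partial>\<^sub>1\<close> (up to
  scalars) lower the exponent of \<open>x\<^sub>1\<close>.  Each monomial other than \<open>x\<^sub>1^l\<close> is, up to a scalar and
  monomials with a larger exponent of \<open>x\<^sub>1\<close>, the image of such a monomial.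
\<close>

lemma contract_mon_zero_from_x1_power:
  assumes "alternating m \<tau>" and "2 \<le> l" "contract (mon l 0 0 0) \<tau> = 0"
    and q: "lie_deriv (mon 0 0 0 2) \<tau> = 0" "lie_deriv (mon 0 0 1 1) \<tau> = 0" "lie_deriv (mon 0 1 0 1) \<tau> = 0"
    and "a + b + c + d = l"
  shows "contract (mon a b c d) \<tau> = 0"
  using assms(7)
proof (induction "l - a" arbitrary: a b c d rule: less_induct)
  case less
  note lin = linear_contract_arg[OF assms(1)]
  note lin_simps = linear_add[OF lin] linear_diff[OF lin] linear_cmul[OF lin] linear_neg[OF lin]
  consider "a = l" "b = 0" "c = 0" "d = 0" | "0 < d" | "d = 0" "0 < c" | "d = 0" "c = 0" "0 < b"
    using less.prems by linarith
  then show ?case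
  proof cases
    case 1
    then show ?thesis using assms(3) by simp
  next
    case 2
    have "contract (mon (a + 1) b c (d - 1)) \<tau> = 0"
      by (rule less.hyps) (use 2 less.prems in auto)
    from contract_bracket_eq_0[OF q(1) this] show ?thesis
      using 2 less.prems \<open>2 \<le> l\<close> by (simp add: bracket_mons lin_simps)
  next
    case 3
    have "contract (mon (a + 1) b (c - 1) 0) \<tau> = 0"
      by (rule less.hyps) (use 3 less.prems in auto)
    note h = contract_bracket_eq_0[OF q(2) this]
    have "contract (mon (a + 1) (b - 1) (c - 1) 1) \<tau> = 0" if "b \<noteq> 0"
      by (rule less.hyps) (use 3 less.prems that in auto)
    with h show ?thesis
      using 3 less.prems \<open>2 \<le> l\<close> by (cases "b = 0") (auto simp add: bracket_mons lin_simps)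
  next
    case 4
    have "contract (mon (a + 1) (b - 1) 0 0) \<tau> = 0"
      by (rule less.hyps) (use 4 less.prems in auto)
    from contract_bracket_eq_0[OF q(3) this] show ?thesis
      using 4 less.prems \<open>2 \<le> l\<close> by (simp add: bracket_mons lin_simps)
  qed
qed

text \<open>
  The mirror image under exchange of \<open>x\<^sub>1\<close> and \<open>x\<^sub>4\<close>.  The three quadratic polynomials used here
  have zero bracket with \<open>x\<^sub>1^l\<close>, which is why the lemma applies to the second argument once the first one is
  \<open>x\<^sub>1^l\<close>.
\<close>

lemma contract_mon_zero_from_x4_power:
  assumes "alternating m \<tau>" and "2 \<le> l" "contract (mon 0 0 0 l) \<tau> = 0"
    and q: "lie_deriv (mon 2 0 0 0) \<tau> = 0" "lie_deriv (mon 1 1 0 0) \<tau> = 0" "lie_deriv (mon 1 0 1 0) \<tau> = 0"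
    and "a + b + c + d = l"
  shows "contract (mon a b c d) \<tau> = 0"
  using assms(7)
proof (induction "l - d" arbitrary: a b c d rule: less_induct)
  case less
  note lin = linear_contract_arg[OF assms(1)]
  note lin_simps = linear_add[OF lin] linear_diff[OF lin] linear_cmul[OF lin] linear_neg[OF lin]
  consider "d = l" "a = 0" "b = 0" "c = 0" | "0 < a" | "a = 0" "0 < b" | "a = 0" "b = 0" "0 < c"
    using less.prems by linarith
  then show ?case
  proof cases
    case 1
    then show ?thesis using assms(3) by simp
  next
    case 2
    have "contract (mon (a - 1) b c (d + 1)) \<tau> = 0"
      by (rule less.hyps) (use 2 less.prems in auto)
    from contract_bracket_eq_0[OF q(1) this] show ?thesis
      using 2 less.prems \<open>2 \<le> l\<close> by (simp add: bracket_mons lin_simps)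
  next
    case 3
    have "contract (mon 0 (b - 1) c (d + 1)) \<tau> = 0"
      by (rule less.hyps) (use 3 less.prems in auto)
    note h = contract_bracket_eq_0[OF q(2) this]
    have "contract (mon 1 (b - 1) (c - 1) (d + 1)) \<tau> = 0" if "c \<noteq> 0"
      by (rule less.hyps) (use 3 less.prems that in auto)
    with h show ?thesis
      using 3 less.prems \<open>2 \<le> l\<close> by (cases "c = 0") (auto simp add: bracket_mons lin_simps)
  next
    case 4
    have "contract (mon 0 0 (c - 1) (d + 1)) \<tau> = 0"
      by (rule less.hyps) (use 4 less.prems in auto)
    from contract_bracket_eq_0[OF q(3) this] show ?thesis
      using 4 less.prems \<open>2 \<le> l\<close> by (simp add: bracket_mons lin_simps)
  qed
qed

lemma invariant_mon:
  assumes "invariant \<sigma>" "a + b + c + d = 2"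
  shows "lie_deriv (mon a b c d) \<sigma> = 0"
  using assms by (simp add: invariant_def mon_homogeneous)

lemma invariant_contract_mon_zero:
  assumes "alternating m \<sigma>" "invariant \<sigma>" "contract (mon l 0 0 0) \<sigma> = 0"
    and "a + b + c + d = l" "2 \<le> l"
  shows "contract (mon a b c d) \<sigma> = 0"
  by (rule contract_mon_zero_from_x1_power[OF assms(1,5,3) _ _ _ assms(4)]) (simp_all add: assms(2) invariant_mon)

lemma stabiliser_contract_mon_zero:
  assumes "alternating (Suc m) \<sigma>" "invariant \<sigma>" "2 \<le> k"
    and "contract (mon 0 0 0 l) (contract (mon k 0 0 0) \<sigma>) = 0"
    and "a + b + c + d = l" "2 \<le> l"
  shows "contract (mon a b c d) (contract (mon k 0 0 0) \<sigma>) = 0"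
  by (rule contract_mon_zero_from_x4_power[OF alternating_contract[OF assms(1)] assms(6,4) _ _ _ assms(5)])
    (rule lie_deriv_contract_stable[OF assms(1)]; use assms(3) in \<open>simp add: bracket_mons invariant_mon assms(2)\<close>)+

lemma horizontal_alternating: "horizontal m D \<sigma> \<Longrightarrow> alternating m \<sigma>"
  by (simp add: horizontal_def)

text \<open>
  \<open>x\<^sub>1^6\<close> has nonzero weight, and it generates.
\<close>

lemma invariant_1_form_zero:
  assumes "horizontal 1 6 \<sigma>" "invariant \<sigma>"
  shows "\<sigma> = 0"
proof (rule horizontal_zero_if_contract_mon[of 0 6])
  have alt: "alternating (Suc 0) \<sigma>" using assms(1) by (simp add: horizontal_def)
  have top: "contract (mon 6 0 0 0) \<sigma> = 0"
    by (rule contract_zero_if_weight_nonzero[OF alt, of "mon 1 0 0 1" 0 _ "- 6"])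
      (simp_all add: invariant_mon[OF assms(2)] bracket_mons zero_fun_def)
  show "contract (mon a b c d) \<sigma> = 0" if "0 = 0 \<longrightarrow> int (a + b + c + d) = 6" for a b c d
    by (rule invariant_contract_mon_zero[OF alt assms(2) top]) (use that in auto)
qed (use assms in auto)

text \<open>
  The value on \<open>(x\<^sub>1^l, x\<^sub>4^k)\<close> vanishes by weight unless \<open>l = k = 4\<close>.  In that case the invariant
  bilinear form on quartics is symmetric, because 4 is even, so there is no alternating one; the
  proof transports the zero value on \<open>(x\<^sub>1^2 x\<^sub>4^2, x\<^sub>1^2 x\<^sub>4^2)\<close> to \<open>(x\<^sub>1^4, x\<^sub>4^4)\<close> along the
  \<open>sl(2)\<close> in \<open>x\<^sub>1, x\<^sub>4\<close>.
\<close>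

lemma invariant_2_form_zero:
  assumes "horizontal 2 8 \<sigma>" "invariant \<sigma>"
  shows "\<sigma> = 0"
proof (rule horizontal_zero_if_contract_mon[of 1 8])
  show hor: "horizontal (Suc 1) 8 \<sigma>" using assms(1) by (simp add: numeral_2_eq_2)
  note alt = horizontal_alternating[OF hor]
  have lin1: "linear (\<lambda>f. \<sigma> [f, g])" and lin2: "linear (\<lambda>f. \<sigma> [g, f])" for g
    using alternating_linear[OF alt, of "[]" "[g]"] alternating_linear[OF alt, of "[g]" "[]"] by simp_all
  note lin_simps = lin1[THEN linear_cmul] lin1[THEN linear_neg] lin2[THEN linear_cmul] lin2[THEN linear_neg]
    lin1[THEN linear_0] lin2[THEN linear_0] numeral_2_eq_2[symmetric]
  have inv: "\<sigma> [bracket q f, g] + \<sigma> [f, bracket q g] = 0" if "q \<in> homogeneous 2" for q f g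
  proof -
    have "lie_deriv q \<sigma> [f, g] = 0"
      using that assms(2) by (simp add: invariant_def)
    then show ?thesis by (simp add: lie_deriv_Cons lie_deriv_Nil contract_def)
  qed
  have sq: "\<sigma> [mon 2 0 0 2, mon 2 0 0 2] = 0"
    using alternating_swap[OF alt, of "[]" "mon 2 0 0 2" "mon 2 0 0 2" "[]"] by simp
  have "\<sigma> [mon 3 0 0 1, mon 1 0 0 3] = 0"
    using inv[of "mon 0 0 0 2" "mon 3 0 0 1" "mon 2 0 0 2"] sq
    by (simp add: bracket_mons lin_simps mon_homogeneous)
  then have quartic: "\<sigma> [mon 4 0 0 0, mon 0 0 0 4] = 0"
    using inv[of "mon 0 0 0 2" "mon 4 0 0 0" "mon 1 0 0 3"]
    by (simp add: bracket_mons lin_simps mon_homogeneous)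
  fix a b c d :: nat
  define l where "l = a + b + c + d"
  assume "3 \<le> a + b + c + d" "3 * int 1 + int (a + b + c + d) \<le> 8"
  then have l: "3 \<le> l" "l \<le> 5" by (simp_all add: l_def)
  let ?\<rho> = "contract (mon l 0 0 0) \<sigma>"
  have hor1: "horizontal (Suc 0) (8 - int l) ?\<rho>"
    using horizontal_contract[OF hor, of "mon l 0 0 0" l] l by (simp add: mon_homogeneous)
  note alt1 = horizontal_alternating[OF hor1]
  have top: "contract (mon 0 0 0 (8 - l)) ?\<rho> = 0"
  proof (cases "l = 4")
    case True
    then show ?thesis using quartic contract_eq_0_iff[OF alt1] by (simp add: contract_def)
  next
    case False
    have "lie_deriv (mon 1 0 0 1) \<sigma> = 0 *\<^sub>R \<sigma>"
      using assms(2) by (simp add: invariant_mon zero_fun_def)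
    from lie_deriv_contract_eigen[OF alt this, of "mon l 0 0 0" "- real l"] l
    have "lie_deriv (mon 1 0 0 1) ?\<rho> = (0 + (- real l)) *\<^sub>R ?\<rho>"
      by (simp add: bracket_mons)
    then show ?thesis
      by (rule contract_zero_if_weight_nonzero[OF alt1, where d = "real (8 - l)"]) (use l False in \<open>auto simp: bracket_mons\<close>)
  qed
  have "?\<rho> = 0"
  proof (rule horizontal_zero_if_contract_mon[OF hor1])
    fix a b c d :: nat assume "0 = 0 \<longrightarrow> int (a + b + c + d) = 8 - int l"
    then show "contract (mon a b c d) ?\<rho> = 0"
      by (intro stabiliser_contract_mon_zero[OF alt assms(2) _ top]) (use l in auto)
  qed
  then show "contract (mon a b c d) \<sigma> = 0"
    by (rule invariant_contract_mon_zero[OF alt assms(2)]) (use l in \<open>auto simp: l_def\<close>)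
qed


text \<open>
  The last argument, once the others are annihilated by \<open>x\<^sub>2 \<partial>\<^sub>3\<close> and are weight vectors.  Its weight is
  prescribed, and a monomial divisible by \<open>x\<^sub>2\<close> is the image under \<open>x\<^sub>2 \<partial>\<^sub>3\<close> of a monomial of
  different weight, on which the form vanishes.
\<close>

lemma extremal_weight:
  assumes alt: "alternating (Suc 0) \<tau>" and x: "lie_deriv (mon 0 2 0 0) \<tau> = 0"
    and h: "lie_deriv (mon 1 0 0 1) \<tau> = u *\<^sub>R \<tau>" "lie_deriv (mon 0 1 1 0) \<tau> = v *\<^sub>R \<tau>"
    and l: "2 \<le> a + b + c + d" and nz: "contract (mon a b c d) \<tau> \<noteq> 0"
  shows "b = 0 \<and> real c = - v \<and> real d - real a = - u"
proof -
  have w1: "real d - real a = - u"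
    using contract_zero_if_weight_nonzero[OF alt h(1) bracket_mon(9)[OF l]] nz by force
  have w2: "real c - real b = - v"
    using contract_zero_if_weight_nonzero[OF alt h(2) bracket_mon(10)[OF l]] nz by force
  have "b = 0"
  proof (rule ccontr)
    assume "b \<noteq> 0"
    then have l': "2 \<le> a + (b - 1) + (c + 1) + d" using l by simp
    have "contract (mon a (b - 1) (c + 1) d) \<tau> = 0"
      by (rule contract_zero_if_weight_nonzero[OF alt h(2) bracket_mon(10)[OF l']]) (use w2 \<open>b \<noteq> 0\<close> in auto)
    from contract_bracket_eq_0[OF x this] show False
      using nz \<open>b \<noteq> 0\<close> unfolding bracket_mon(2)[OF l']
      by (simp add: linear_contract_arg[OF alt, THEN linear_cmul])
  qed
  then show ?thesis using w1 w2 by simp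
qed

text \<open>
  The degrees are 3, 3, 4 in some order.  With first arguments \<open>x\<^sub>1^3, x\<^sub>4^3\<close> the quartic argument can
  only be \<open>x\<^sub>1^2 x\<^sub>4^2\<close>.  The other orders follow by alternation, since a contraction with a quartic
  leaves two cubic arguments.
\<close>

lemma invariant_3_form_zero:
  assumes hor3: "horizontal (Suc 2) 10 \<sigma>" and inv: "invariant \<sigma>"
    and zero: "\<sigma> [mon 3 0 0 0, mon 0 0 0 3, mon 2 0 0 2] = 0"
  shows "\<sigma> = 0"
proof -
  note alt3 = horizontal_alternating[OF hor3]
  define \<rho>1 where "\<rho>1 = contract (mon 3 0 0 0) \<sigma>"
  have hor2: "horizontal (Suc 1) 7 \<rho>1"
    using horizontal_contract[OF hor3, of "mon 3 0 0 0" 3] by (simp add: \<rho>1_def mon_homogeneous numeral_2_eq_2)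
  note alt2 = horizontal_alternating[OF hor2]
  define \<rho>2 where "\<rho>2 = contract (mon 0 0 0 3) \<rho>1"
  have hor1: "horizontal (Suc 0) 4 \<rho>2"
    using horizontal_contract[OF hor2, of "mon 0 0 0 3" 3] by (simp add: \<rho>2_def mon_homogeneous)
  note alt1 = horizontal_alternating[OF hor1]
  have stable: "lie_deriv q \<rho>2 = 0 *\<^sub>R \<rho>2"
    if "q \<in> homogeneous 2" "bracket q (mon 3 0 0 0) = r *\<^sub>R mon 3 0 0 0"
      "bracket q (mon 0 0 0 3) = (- r) *\<^sub>R mon 0 0 0 3" for q r
  proof -
    have "lie_deriv q \<sigma> = 0 *\<^sub>R \<sigma>"
      using inv that(1) by (simp add: invariant_def zero_fun_def)
    from lie_deriv_contract_eigen[OF alt3 this that(2)]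
    have "lie_deriv q \<rho>1 = (0 + r) *\<^sub>R \<rho>1" by (simp only: \<rho>1_def)
    from lie_deriv_contract_eigen[OF alt2 this that(3)]
    show ?thesis by (simp add: \<rho>2_def zero_fun_def)
  qed
  have "contract (mon a b c d) \<rho>2 = 0" if "a + b + c + d = 4" for a b c d
  proof (rule ccontr)
    assume nz: "contract (mon a b c d) \<rho>2 \<noteq> 0"
    have e1: "lie_deriv (mon 0 2 0 0) \<rho>2 = 0"
      using stable[of "mon 0 2 0 0" 0] by (simp add: bracket_mons mon_homogeneous zero_fun_def)
    have e2: "lie_deriv (mon 1 0 0 1) \<rho>2 = 0 *\<^sub>R \<rho>2"
      by (rule stable[of _ "- 3"]) (simp_all add: bracket_mons mon_homogeneous)
    have e3: "lie_deriv (mon 0 1 1 0) \<rho>2 = 0 *\<^sub>R \<rho>2"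
      by (rule stable[of _ 0]) (simp_all add: bracket_mons mon_homogeneous)
    have "b = 0" "c = 0" "a = 2" "d = 2"
      using extremal_weight[OF alt1 e1 e2 e3 _ nz] that by auto
    then have "\<rho>2 [mon a b c d] = 0"
      using zero by (simp add: \<rho>2_def \<rho>1_def contract_def)
    then show False using nz contract_eq_0_iff[OF alt1] by simp
  qed
  then have "\<rho>2 = 0"
    by (intro horizontal_zero_if_contract_mon[OF hor1]) auto
  have cubic1: "contract (mon a b c d) \<rho>1 = 0" if "a + b + c + d = 3" for a b c d
    using stabiliser_contract_mon_zero[OF alt3 inv, of 3 3 a b c d] \<open>\<rho>2 = 0\<close> that
    by (simp add: \<rho>1_def \<rho>2_def)
  have "\<rho>1 = 0"
  proof (rule horizontal_zero_if_contract_mon[OF hor2])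
    fix a b c d :: nat assume l: "3 \<le> a + b + c + d" "3 * int 1 + int (a + b + c + d) \<le> 7"
    show "contract (mon a b c d) \<rho>1 = 0"
    proof (cases "a + b + c + d = 3")
      case False
      then have "horizontal (Suc 0) 3 (contract (mon a b c d) \<rho>1)"
        using horizontal_contract[OF hor2, of "mon a b c d" 4] l by (simp add: mon_homogeneous)
      then show ?thesis
        by (rule horizontal_zero_if_contract_mon)
          (use cubic1 contract_contract[OF alt2, of _ "mon a b c d"] in \<open>simp add: contract_zero\<close>)
    qed (rule cubic1)
  qed
  then have cubic: "contract (mon a b c d) \<sigma> = 0" if "a + b + c + d = 3" for a b c d
    using invariant_contract_mon_zero[OF alt3 inv, of 3 a b c d] that by (simp add: \<rho>1_def)
  show "\<sigma> = 0"
  proof (rule horizontal_zero_if_contract_mon[OF hor3])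
    fix a b c d :: nat assume l: "3 \<le> a + b + c + d" "3 * int 2 + int (a + b + c + d) \<le> 10"
    show "contract (mon a b c d) \<sigma> = 0"
    proof (cases "a + b + c + d = 3")
      case False
      then have "horizontal (Suc 1) 6 (contract (mon a b c d) \<sigma>)"
        using horizontal_contract[OF hor3, of "mon a b c d" 4] l by (simp add: mon_homogeneous numeral_2_eq_2)
      then show ?thesis
        by (rule horizontal_zero_if_contract_mon)
          (use cubic contract_contract[OF alt3, of _ "mon a b c d"] in \<open>simp add: contract_zero\<close>)
    qed (rule cubic)
  qed
qed

lemma four_slots:
  assumes "alternating 4 \<sigma>"
  shows "linear (\<lambda>f. \<sigma> [f, g, h, k])" "linear (\<lambda>f. \<sigma> [g, f, h, k])"
    "linear (\<lambda>f. \<sigma> [g, h, f, k])" "linear (\<lambda>f. \<sigma> [g, h, k, f])"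
    and "\<sigma> [f, g, h, k] = - \<sigma> [g, f, h, k]" "\<sigma> [f, g, h, k] = - \<sigma> [f, h, g, k]"
    "\<sigma> [f, g, h, k] = - \<sigma> [f, g, k, h]"
  using alternating_linear[OF assms, of "[]" "[g, h, k]"] alternating_linear[OF assms, of "[g]" "[h, k]"]
    alternating_linear[OF assms, of "[g, h]" "[k]"] alternating_linear[OF assms, of "[g, h, k]" "[]"]
    alternating_swap[OF assms, of "[]" f g "[h, k]"] alternating_swap[OF assms, of "[f]" g h "[k]"]
    alternating_swap[OF assms, of "[f, g]" h k "[]"]
  by simp_all

text \<open>
  The values that determine an invariant form on cubics; \<open>i + j + k = 3\<close>.  The exponents of the last
  argument are forced by the weights.
\<close>

abbreviation slice :: "form \<Rightarrow> nat \<Rightarrow> nat \<Rightarrow> nat \<Rightarrow> real"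
  where "slice \<sigma> i j k \<equiv> \<sigma> [mon 3 0 0 0, mon 0 0 0 3, mon i k 0 j, mon j 0 k i]"

text \<open>
  In terms of the cubic symmetric polynomials mentioned at the beginning, the normal form of the four
  vectors makes \<open>X + Y + Z\<close>, \<open>Y\<close> and \<open>Z\<close> independent variables, and \<open>slice \<sigma> i j k\<close> is, up to
  a constant, the coefficient of \<open>(X + Y + Z)^k Y^j Z^i\<close>.  Symmetry in \<open>X, Y, Z\<close> leaves three
  free coefficients, for instance those of the hypotheses.  The proof finds the linear relations
  between the slices directly, by applying suitable quadratic polynomials to suitable arguments.
\<close>

lemma slices_zero:
  assumes alt: "alternating 4 \<sigma>" and "invariant \<sigma>"
    and zero: "slice \<sigma> 0 0 3 = 0" "slice \<sigma> 1 0 2 = 0" "slice \<sigma> 2 1 0 = 0"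
    and "i + j + k = 3"
  shows "slice \<sigma> i j k = 0"
proof -
  note lin = four_slots(1-4)[OF alt]
  note lin_simps = lin[THEN linear_add] lin[THEN linear_diff] lin[THEN linear_cmul] lin[THEN linear_0]
    lin[THEN linear_neg]
  note swap = four_slots(5-7)[OF alt]
  have rep: "\<sigma> [f, f, g, h] = 0" "\<sigma> [g, f, f, h] = 0" "\<sigma> [g, h, f, f] = 0" for f g h
    using swap(1)[of f f g h] swap(2)[of g f f h] swap(3)[of g h f f] by simp_all
  have rep2: "\<sigma> [f, g, f, h] = 0" "\<sigma> [g, f, h, f] = 0" for f g h
    using swap(2)[of f g f h] swap(3)[of g f h f] rep by simp_all
  have rep3: "\<sigma> [f, g, h, f] = 0" for f g h
    using swap(3)[of f g h f] rep2 by simp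
  note rep = rep rep2 rep3
  have inv: "\<sigma> [bracket q f, g, h, k] + \<sigma> [f, bracket q g, h, k] + \<sigma> [f, g, bracket q h, k]
      + \<sigma> [f, g, h, bracket q k] = 0" if "q \<in> homogeneous 2" for q f g h k
  proof -
    have "lie_deriv q \<sigma> [f, g, h, k] = 0"
      using that assms(2) by (simp add: invariant_def)
    then show ?thesis by (simp add: lie_deriv_Cons lie_deriv_Nil contract_def)
  qed
  let ?A = "mon 3 0 0 0" and ?B = "mon 0 0 0 3"
  note s = bracket_mons lin_simps mon_homogeneous rep numeral_2_eq_2[symmetric]
  have s12: "slice \<sigma> 1 2 0 = 0"
    using zero(3) swap(3)[of ?A ?B "mon 1 0 0 2" "mon 2 0 0 1"] by simp
  \<comment> \<open>The first argument contributes nothing: its image is a multiple of the third argument.\<close>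
  have s20: "slice \<sigma> 2 0 1 = 0"
    using inv[of "mon 0 1 0 1" ?A ?B "mon 2 1 0 0" "mon 0 0 2 1"] zero(2) by (simp add: s)
  \<comment> \<open>The operator \<open>x\<^sub>2 \<partial>\<^sub>3\<close> relates a slice to the one with \<open>x\<^sub>2\<close> and \<open>x\<^sub>3\<close>, hence \<open>i\<close> and \<open>j\<close>,
    exchanged.\<close>
  have s02: "slice \<sigma> 0 2 1 = 0"
    using inv[of "mon 0 2 0 0" ?A ?B "mon 0 0 1 2" "mon 2 0 1 0"] s20
      swap(3)[of ?A ?B "mon 2 1 0 0" "mon 0 0 1 2"] by (simp add: s)
  have s01: "slice \<sigma> 0 1 2 = 0"
    using inv[of "mon 0 2 0 0" ?A ?B "mon 0 1 1 1" "mon 1 0 2 0"]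
      inv[of "mon 0 2 0 0" ?A ?B "mon 0 0 2 1" "mon 1 1 1 0"] zero(2)
      swap(3)[of ?A ?B "mon 1 2 0 0" "mon 0 0 2 1"] by (simp add: s)
  \<comment> \<open>The first and the third equation share the value at
    \<open>x\<^sub>1^3, x\<^sub>1 x\<^sub>4^2, x\<^sub>3 x\<^sub>4^2, x\<^sub>1 x\<^sub>2 x\<^sub>4\<close>, which is eliminated between them.\<close>
  have s11: "slice \<sigma> 1 1 1 = 0"
    using inv[of "mon 1 0 1 0" ?A ?B "mon 1 0 0 2" "mon 1 1 0 1"]
      inv[of "mon 0 2 0 0" ?A ?B "mon 1 0 0 2" "mon 1 0 2 0"]
      inv[of "mon 2 0 0 0" ?A ?B "mon 0 0 1 2" "mon 1 1 0 1"]
      s20 zero(3) s12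
      swap(2)[of ?A "mon 1 0 0 2" "mon 0 0 1 2" "mon 1 1 0 1"]
      swap(3)[of ?A ?B "mon 1 1 0 1" "mon 1 0 1 1"]
      swap(3)[of ?A ?B "mon 2 1 0 0" "mon 0 0 1 2"]
    by (simp add: s)
  have "i = 3 \<and> j = 0 \<and> k = 0 \<or> i = 0 \<and> j = 3 \<and> k = 0 \<or> i = 2 \<and> j = 1 \<and> k = 0 \<or>
    i = 1 \<and> j = 2 \<and> k = 0 \<or> i = 2 \<and> j = 0 \<and> k = 1 \<or> i = 0 \<and> j = 2 \<and> k = 1 \<or>
    i = 1 \<and> j = 1 \<and> k = 1 \<or> i = 1 \<and> j = 0 \<and> k = 2 \<or> i = 0 \<and> j = 1 \<and> k = 2 \<or>
    i = 0 \<and> j = 0 \<and> k = 3"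
    using assms(6) by presburger
  then show ?thesis
    using s12 s20 s02 s01 s11 zero rep by auto
qed

text \<open>
  After \<open>x\<^sub>1^3\<close> and \<open>x\<^sub>4^3\<close>, the third argument is generated under \<open>x\<^sub>3 \<partial>\<^sub>2\<close> by the monomials
  without \<open>x\<^sub>3\<close>, and these are annihilated by \<open>x\<^sub>2 \<partial>\<^sub>3\<close>, so that the last argument can be treated by
  \<open>extremal_weight\<close>.
\<close>

lemma invariant_4_form_zero:
  assumes hor: "horizontal 4 12 \<sigma>" and inv: "invariant \<sigma>"
    and zero: "slice \<sigma> 0 0 3 = 0" "slice \<sigma> 1 0 2 = 0" "slice \<sigma> 2 1 0 = 0"
  shows "\<sigma> = 0"
proof -
  have hor4: "horizontal (Suc 3) 12 \<sigma>" using hor by simp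
  note alt4 = horizontal_alternating[OF hor4]
  define \<rho>1 where "\<rho>1 = contract (mon 3 0 0 0) \<sigma>"
  have hor3: "horizontal (Suc 2) 9 \<rho>1"
    using horizontal_contract[OF hor4, of "mon 3 0 0 0" 3] by (simp add: \<rho>1_def mon_homogeneous)
  note alt3 = horizontal_alternating[OF hor3]
  define \<rho>2 where "\<rho>2 = contract (mon 0 0 0 3) \<rho>1"
  have hor2: "horizontal (Suc 1) 6 \<rho>2"
    using horizontal_contract[OF hor3, of "mon 0 0 0 3" 3] by (simp add: \<rho>2_def mon_homogeneous numeral_2_eq_2)
  note alt2 = horizontal_alternating[OF hor2]
  have stable: "lie_deriv q \<rho>2 = 0"
    if "q \<in> homogeneous 2" "bracket q (mon 3 0 0 0) = r *\<^sub>R mon 3 0 0 0"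
      "bracket q (mon 0 0 0 3) = (- r) *\<^sub>R mon 0 0 0 3" for q r
  proof -
    have "lie_deriv q \<sigma> = 0 *\<^sub>R \<sigma>"
      using inv that(1) by (simp add: invariant_def zero_fun_def)
    from lie_deriv_contract_eigen[OF alt4 this that(2)]
    have "lie_deriv q \<rho>1 = (0 + r) *\<^sub>R \<rho>1" by (simp only: \<rho>1_def)
    from lie_deriv_contract_eigen[OF alt3 this that(3)]
    show ?thesis by (simp add: \<rho>2_def zero_fun_def)
  qed
  have slice: "contract (mon a b c d) (contract (mon i k 0 j) \<rho>2) = 0"
    if "i + j + k = 3" "a + b + c + d = 3" for i j k a b c d
  proof (rule ccontr)
    let ?\<tau> = "contract (mon i k 0 j) \<rho>2"
    assume nz: "contract (mon a b c d) ?\<tau> \<noteq> 0"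
    have alt1: "alternating (Suc 0) ?\<tau>"
      using alternating_contract[OF alt2] by simp
    have e1: "lie_deriv (mon 0 2 0 0) ?\<tau> = 0"
      by (rule lie_deriv_contract_stable[OF alt2 stable[of _ 0]])
        (use that in \<open>simp_all add: bracket_mons mon_homogeneous\<close>)
    have z: "lie_deriv q \<rho>2 = 0 *\<^sub>R \<rho>2" if "lie_deriv q \<rho>2 = 0" for q
      using that by (simp add: zero_fun_def)
    have e2: "lie_deriv (mon 1 0 0 1) ?\<tau> = (0 + (real j - real i)) *\<^sub>R ?\<tau>"
      by (rule lie_deriv_contract_eigen[OF alt2 z[OF stable[of _ "- 3"]]])
        (use that in \<open>simp_all add: bracket_mons mon_homogeneous\<close>)
    have e3: "lie_deriv (mon 0 1 1 0) ?\<tau> = (0 + (0 - real k)) *\<^sub>R ?\<tau>"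
      by (rule lie_deriv_contract_eigen[OF alt2 z[OF stable[of _ 0]]])
        (use that in \<open>simp_all add: bracket_mons mon_homogeneous\<close>)
    have "b = 0 \<and> real c = - (0 + (0 - real k)) \<and> real d - real a = - (0 + (real j - real i))"
      using extremal_weight[OF alt1 e1 e2 e3 _ nz] that by simp
    then have "b = 0" "c = k" "a = j" "d = i" using that by auto
    then have "?\<tau> [mon a b c d] = 0"
      using slices_zero[OF _ inv zero that(1)] hor horizontal_alternating
      by (simp add: \<rho>2_def \<rho>1_def contract_def)
    then show False using nz contract_eq_0_iff[OF alt1] by simp
  qed
  have third: "contract (mon i a b j) \<rho>2 = 0" if "i + a + b + j = 3" for i a b j
    using that
  proof (induction b arbitrary: a)
    case 0
    show ?case
    proof (rule horizontal_zero_if_contract_mon)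
      show "horizontal (Suc 0) 3 (contract (mon i a 0 j) \<rho>2)"
        using horizontal_contract[OF hor2, of "mon i a 0 j" 3] 0 by (simp add: mon_homogeneous)
    qed (use slice 0 in auto)
  next
    case (Suc b)
    have "contract (bracket (mon 0 0 2 0) (mon i (a + 1) b j)) \<rho>2 = 0"
      by (rule contract_bracket_eq_0[OF stable[of _ 0] Suc.IH])
        (use Suc.prems in \<open>simp_all add: bracket_mons mon_homogeneous\<close>)
    moreover have "bracket (mon 0 0 2 0) (mon i (a + 1) b j) = (- 2 * real (a + 1)) *\<^sub>R mon i a (b + 1) j"
      using Suc.prems by (subst bracket_mon) simp_all
    ultimately show ?case
      by (simp only: linear_cmul[OF linear_contract_arg[OF alt2]] scaleR_eq_0_iff) simp
  qed
  have "\<rho>2 = 0"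
    by (rule horizontal_zero_if_contract_mon[OF hor2]) (use third in auto)
  have "\<rho>1 = 0"
  proof (rule horizontal_zero_if_contract_mon[OF hor3])
    fix a b c d :: nat assume "3 \<le> a + b + c + d" "3 * int 2 + int (a + b + c + d) \<le> 9"
    then show "contract (mon a b c d) \<rho>1 = 0"
      using stabiliser_contract_mon_zero[OF alt4 inv, of 3 3 a b c d] \<open>\<rho>2 = 0\<close>
      by (simp add: \<rho>1_def \<rho>2_def)
  qed
  show "\<sigma> = 0"
  proof (rule horizontal_zero_if_contract_mon[OF hor4])
    fix a b c d :: nat assume "3 \<le> a + b + c + d" "3 * int 3 + int (a + b + c + d) \<le> 12"
    then show "contract (mon a b c d) \<sigma> = 0"
      using invariant_contract_mon_zero[OF alt4 inv, of 3 a b c d] \<open>\<rho>1 = 0\<close>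
      by (simp add: \<rho>1_def)
  qed
qed


section \<open>Derivatives at the origin\<close>

text \<open>
  Unlike the definition of \<open>pd\<close>, this formula contains no sum and no truncated subtraction.
\<close>

lemma lookup_pd: "Poly_Mapping.lookup (pd i p) \<beta> =
    real (\<beta> $ i + 1) * Poly_Mapping.lookup p (\<beta> + axis i 1)"
proof -
  let ?f = "\<lambda>\<alpha>. Poly_Mapping.lookup
      (Poly_Mapping.single (\<alpha> - axis i 1) (real (\<alpha> $ i) * Poly_Mapping.lookup p \<alpha>)) \<beta>"
  have "?f \<alpha> = (if \<alpha> = \<beta> + axis i 1 then real (\<beta> $ i + 1) * Poly_Mapping.lookup p \<alpha> else 0)" for \<alpha>
  proof (cases "\<alpha> $ i = 0")
    case True
    then have "\<alpha> \<noteq> \<beta> + axis i 1" by (auto simp: axis_def)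
    then show ?thesis using True by simp
  next
    case False
    then have "\<alpha> - axis i 1 = \<beta> \<longleftrightarrow> \<alpha> = \<beta> + axis i 1"
      by (auto simp: vec_eq_iff axis_def)
    then show ?thesis by (auto simp: lookup_single when_def axis_def)
  qed
  then have "Poly_Mapping.lookup (pd i p) \<beta> = (\<Sum>\<alpha>\<in>Poly_Mapping.keys p.
      if \<alpha> = \<beta> + axis i 1 then real (\<beta> $ i + 1) * Poly_Mapping.lookup p \<alpha> else 0)"
    unfolding pd_def lookup_sum by (rule sum.cong[OF refl])
  then show ?thesis by (auto simp: sum.delta in_keys_iff)
qed

lemma lookup_scaleR: "Poly_Mapping.lookup (r *\<^sub>R p) k = r * Poly_Mapping.lookup p k"
  by (simp add: scaleR_poly_mapping_def)

lemma pd_add: "pd i (p + q) = pd i p + pd i q"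
  and pd_scale: "pd i (r *\<^sub>R p) = r *\<^sub>R pd i p"
  by (rule poly_mapping_eqI; simp add: lookup_pd lookup_add lookup_scaleR algebra_simps)+

lemma linear_pd: "linear (pd i)"
  by (rule linearI) (simp_all add: pd_add pd_scale)

lemma pd_commute: "pd i (pd j p) = pd j (pd i p)"
  by (rule poly_mapping_eqI) (auto simp: lookup_pd axis_def add_ac)

lemma pd_mult: "pd i (p * q) = pd i p * q + p * pd i q"
proof -
  have single: "pd i (Poly_Mapping.single \<alpha> a * Poly_Mapping.single \<beta> b) =
      pd i (Poly_Mapping.single \<alpha> a) * Poly_Mapping.single \<beta> b +
      Poly_Mapping.single \<alpha> a * pd i (Poly_Mapping.single \<beta> b)" for \<alpha> \<beta> a b
  proof -
    have 1: "\<alpha> $ i \<noteq> 0 \<Longrightarrow> \<alpha> - axis i 1 + \<beta> = \<alpha> + \<beta> - axis i 1"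
      and 2: "\<beta> $ i \<noteq> 0 \<Longrightarrow> \<alpha> + (\<beta> - axis i 1) = \<alpha> + \<beta> - axis i 1"
      by (auto simp: vec_eq_iff axis_def)
    show ?thesis
      by (cases "\<alpha> $ i = 0"; cases "\<beta> $ i = 0")
        (simp_all add: pd_single Poly_Mapping.mult_single 1 2 del: One_nat_def flip: single_add, simp_all add: algebra_simps)
  qed
  have pd_sum: "pd i (sum f A) = (\<Sum>a\<in>A. pd i (f a))" for f :: "'b \<Rightarrow> poly4" and A
    by (rule linear_sum[OF linear_pd])
  have expand: "p = (\<Sum>\<alpha>\<in>Poly_Mapping.keys p. Poly_Mapping.single \<alpha> (Poly_Mapping.lookup p \<alpha>))" for p :: poly4
    by (rule poly_mapping_eqI) (auto simp: lookup_sum lookup_single when_def sum.delta in_keys_iff)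
  let ?p = "\<Sum>\<alpha>\<in>Poly_Mapping.keys p. Poly_Mapping.single \<alpha> (Poly_Mapping.lookup p \<alpha>)"
    and ?q = "\<Sum>\<alpha>\<in>Poly_Mapping.keys q. Poly_Mapping.single \<alpha> (Poly_Mapping.lookup q \<alpha>)"
  have "pd i (?p * ?q) = pd i ?p * ?q + ?p * pd i ?q"
    by (simp only: sum_product pd_sum single sum.distrib)
  then show ?thesis by (simp only: expand[symmetric])
qed

text \<open>
  The Poisson tensor: its nonzero entries are \<open>eps a\<close> at the positions \<open>(a, mate a)\<close>.
\<close>

definition mate :: "4 \<Rightarrow> 4"
  where "mate a = (if a = 1 then 4 else if a = 2 then 3 else if a = 3 then 2 else 1)"

definition eps :: "4 \<Rightarrow> real"
  where "eps a = (if a = 1 \<or> a = 2 then 1 else - 1)"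

lemma mate_eps_simps [simp]:
  "mate 1 = 4" "mate 2 = 3" "mate 3 = 2" "mate 4 = 1" "eps 1 = 1" "eps 2 = 1" "eps 3 = - 1" "eps 4 = - 1"
  by (simp_all add: mate_def eps_def)

lemma poisson_eps: "poisson f g = (\<Sum>a\<in>UNIV. eps a *\<^sub>R (pd a f * pd (mate a) g))"
  by (simp add: poisson_def sum_4)

fun derivs :: "4 list \<Rightarrow> poly4 \<Rightarrow> poly4"
  where
    "derivs [] p = p"
  | "derivs (a # as) p = derivs as (pd a p)"

definition jet :: "4 list \<Rightarrow> ham \<Rightarrow> real"
  where "jet as f = Poly_Mapping.lookup (derivs as (potential f)) 0"

lemma linear_derivs: "linear (derivs as)"
proof (induction as)
  case Nil
  show ?case by (simp add: linear_iff)
next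
  case (Cons a as)
  then show ?case using linear_compose[OF linear_pd Cons] by (simp add: o_def)
qed

lemma keys_derivs:
  "\<beta> \<in> Poly_Mapping.keys (derivs as p) \<Longrightarrow> \<exists>\<alpha>\<in>Poly_Mapping.keys p. tdeg \<alpha> = tdeg \<beta> + length as"
proof (induction as arbitrary: p)
  case (Cons a as)
  then show ?case using keys_pd by fastforce
qed auto

lemma jet_dual: "jet as \<in> dual_homogeneous (length as)"
  unfolding dual_homogeneous_def
proof (intro CollectI conjI allI impI ballI)
  show "linear (jet as)"
    by (rule linearI) (simp_all add: jet_def plus_ham.rep_eq scaleR_ham.rep_eq lookup_add
        linear_add[OF linear_derivs] linear_cmul[OF linear_derivs] lookup_scaleR)
  fix k f assume "k \<noteq> length as" "f \<in> homogeneous k"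
  then have "0 \<notin> Poly_Mapping.keys (derivs as (potential f))"
    using keys_derivs[of 0 as "potential f"] by (auto simp: homogeneous_def tdeg_def)
  then show "jet as f = 0" by (simp add: jet_def in_keys_iff)
qed

definition hess :: "poly4 \<Rightarrow> 4 \<Rightarrow> 4 \<Rightarrow> real"
  where "hess \<xi> a b = Poly_Mapping.lookup (pd b (pd a \<xi>)) 0"

lemma hess_sym: "hess \<xi> a b = hess \<xi> b a"
  by (simp add: hess_def pd_commute)

lemma lookup_0_mult: "Poly_Mapping.lookup (p * q :: poly4) 0 = 0" if "Poly_Mapping.lookup p 0 = 0"
proof -
  have "0 \<notin> Poly_Mapping.keys (p * q)"
  proof
    assume "0 \<in> Poly_Mapping.keys (p * q)"
    then obtain \<alpha> \<beta> where "0 = \<alpha> + \<beta>" "\<alpha> \<in> Poly_Mapping.keys p"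
      using keys_mult[of p q] by blast
    moreover from this(1) have "\<alpha> = 0" by (simp add: vec_eq_iff)
    ultimately show False using that by (simp add: in_keys_iff)
  qed
  then show ?thesis by (simp add: in_keys_iff)
qed

lemma single_0_mult: "Poly_Mapping.single 0 r * (g :: poly4) = r *\<^sub>R g"
  by (rule poly_mapping_eqI) (simp add: lookup_scaleR mult_map_scale_conv_mult[symmetric] map.rep_eq when_def)

lemma pd_pd_quadratic:
  assumes "\<forall>\<alpha>\<in>Poly_Mapping.keys \<xi>. tdeg \<alpha> = 2"
  shows "pd b (pd a \<xi>) * g = hess \<xi> a b *\<^sub>R g"
proof -
  have "Poly_Mapping.lookup (pd b (pd a \<xi>)) \<beta> = 0" if "\<beta> \<noteq> 0" for \<beta>
  proof (rule ccontr)
    assume "\<not> ?thesis"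
    then have "\<beta> \<in> Poly_Mapping.keys (derivs [a, b] \<xi>)" by (simp add: in_keys_iff)
    from keys_derivs[OF this] assms have "tdeg \<beta> = 0" by auto
    then show False using that by (auto simp: tdeg_def vec_eq_iff)
  qed
  then have "pd b (pd a \<xi>) = Poly_Mapping.single 0 (hess \<xi> a b)"
    by (intro poly_mapping_eqI) (auto simp: hess_def lookup_single when_def)
  then show ?thesis by (simp add: single_0_mult)
qed

text \<open>
  Differentiating \<open>{\<xi>, g}\<close> once: the first summand is \<open>{\<partial>\<^sub>a \<xi>, g}\<close> for the linear polynomial
  \<open>\<partial>\<^sub>a \<xi>\<close>, which is a constant vector field applied to \<open>g\<close>.
\<close>

lemma pd_poisson:
  assumes "\<forall>\<alpha>\<in>Poly_Mapping.keys \<xi>. tdeg \<alpha> = 2"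
  shows "pd a (poisson \<xi> g) = (\<Sum>b\<in>UNIV. (eps b * hess \<xi> a b) *\<^sub>R pd (mate b) g) + poisson \<xi> (pd a g)"
  by (simp add: poisson_eps linear_sum[OF linear_pd] pd_scale pd_mult pd_commute[of a] pd_pd_quadratic[OF assms]
      sum.distrib scaleR_add_right hess_sym[of _ _ a])

text \<open>
  The derivatives of order \<open>l\<close> at the origin form a tensor on which the quadratic \<open>\<xi>\<close> acts index by
  index through its Hessian.  Indices are labels of slots \<open>h\<close> ("half-edges"), so that an index is
  replaced by updating the labelling.
\<close>

lemma derivs_poisson:
  assumes "\<forall>\<alpha>\<in>Poly_Mapping.keys \<xi>. tdeg \<alpha> = 2" and "distinct hs"
  shows "Poly_Mapping.lookup (derivs (map lab hs) (poisson \<xi> g)) 0 =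
    (\<Sum>h\<in>set hs. \<Sum>b\<in>UNIV. eps b * hess \<xi> (lab h) b *
      Poly_Mapping.lookup (derivs (map (lab(h := mate b)) hs) g) 0)"
  using assms(2)
proof (induction hs arbitrary: g)
  case Nil
  have "Poly_Mapping.lookup (pd a \<xi>) 0 = 0" for a
    using keys_pd[of 0 a \<xi>] assms(1) by (fastforce simp: tdeg_def in_keys_iff)
  then show ?case
    by (simp add: poisson_eps lookup_sum lookup_scaleR lookup_0_mult)
next
  case (Cons h hs)
  note lin = linear_derivs[of "map lab hs"]
  have upd: "map (lab(h := x)) hs = map lab hs" for x
    using Cons.prems by auto
  have "Poly_Mapping.lookup (derivs (map lab (h # hs)) (poisson \<xi> g)) 0 =
      (\<Sum>b\<in>UNIV. eps b * hess \<xi> (lab h) b * Poly_Mapping.lookup (derivs (map lab hs) (pd (mate b) g)) 0) +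
      Poly_Mapping.lookup (derivs (map lab hs) (poisson \<xi> (pd (lab h) g))) 0"
    by (simp add: pd_poisson[OF assms(1)] linear_add[OF lin] linear_sum[OF lin] linear_cmul[OF lin]
        lookup_add lookup_sum lookup_scaleR)
  also have "(\<Sum>b\<in>UNIV. eps b * hess \<xi> (lab h) b * Poly_Mapping.lookup (derivs (map lab hs) (pd (mate b) g)) 0) =
      (\<Sum>b\<in>UNIV. eps b * hess \<xi> (lab h) b *
        Poly_Mapping.lookup (derivs (map (lab(h := mate b)) (h # hs)) g) 0)"
    by (simp add: upd)
  also have "Poly_Mapping.lookup (derivs (map lab hs) (poisson \<xi> (pd (lab h) g))) 0 =
      (\<Sum>k\<in>set hs. \<Sum>b\<in>UNIV. eps b * hess \<xi> (lab k) b *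
        Poly_Mapping.lookup (derivs (map (lab(k := mate b)) (h # hs)) g) 0)"
    unfolding Cons.IH[OF distinct.simps(2)[THEN iffD1, OF Cons.prems, THEN conjunct2]]
    by (intro sum.cong refl) (use Cons.prems in auto)
  finally have "Poly_Mapping.lookup (derivs (map lab (h # hs)) (poisson \<xi> g)) 0 =
      (\<Sum>b\<in>UNIV. eps b * hess \<xi> (lab h) b *
        Poly_Mapping.lookup (derivs (map (lab(h := mate b)) (h # hs)) g) 0) +
      (\<Sum>k\<in>set hs. \<Sum>b\<in>UNIV. eps b * hess \<xi> (lab k) b *
        Poly_Mapping.lookup (derivs (map (lab(k := mate b)) (h # hs)) g) 0)" .
  moreover have "h \<notin> set hs" using Cons.prems by simp
  ultimately show ?case by (simp only: list.set sum.insert[OF finite_set] not_False_eq_True)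
qed

lemma jet_bracket:
  assumes "q \<in> homogeneous 2" "distinct hs"
  shows "jet (map lab hs) (bracket q g) =
    (\<Sum>h\<in>set hs. \<Sum>b\<in>UNIV. eps b * hess (potential q) (lab h) b * jet (map (lab(h := mate b)) hs) g)"
  using assms derivs_poisson[of "potential q" hs lab "potential g"]
  by (simp add: jet_def bracket.rep_eq homogeneous_def)

section \<open>Invariant forms from graphs\<close>

text \<open>
  The exterior product of the derivative tensors at the vertices; vertex \<open>i\<close> is the list \<open>V ! i\<close> of
  its half-edges.
\<close>

definition jets :: "nat list list \<Rightarrow> (nat \<Rightarrow> 4) \<Rightarrow> form"
  where "jets V lab = wedge_list (map (\<lambda>hs. jet (map lab hs)) V)"

lemma lie_deriv_one_form: "lie_deriv q (one_form z) = one_form (\<lambda>g. - z (bracket q g))"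
proof
  show "lie_deriv q (one_form z) fs = one_form (\<lambda>g. - z (bracket q g)) fs" for fs
    by (cases fs) (auto simp: lie_deriv_Nil lie_deriv_Cons contract_one_form lie_deriv_scale
        lie_deriv_unit_form one_form_def split: list.split)
qed

lemma lie_deriv_jets:
  assumes "q \<in> homogeneous 2" "distinct (concat V)"
  shows "lie_deriv q (jets V lab) =
    - (\<Sum>h\<in>set (concat V). \<Sum>b\<in>UNIV. (eps b * hess (potential q) (lab h) b) *\<^sub>R jets V (lab(h := mate b)))"
  using assms(2)
proof (induction V)
  case Nil
  show ?case
    by (simp add: jets_def wedge_list_Nil fun_eq_iff lie_deriv_unit_form)
next
  case (Cons hs V)
  let ?c = "\<lambda>h b. eps b * hess (potential q) (lab h) b"
  have d: "distinct hs" "distinct (concat V)" "set hs \<inter> set (concat V) = {}"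
    using Cons.prems by auto
  have jets_Cons: "jets (hs # V) l = wedge (one_form (jet (map l hs))) (jets V l)" for l
    by (simp add: jets_def wedge_list_Cons)
  have "lie_deriv q (one_form (jet (map lab hs))) =
      - (\<Sum>h\<in>set hs. \<Sum>b\<in>UNIV. ?c h b *\<^sub>R one_form (jet (map (lab(h := mate b)) hs)))"
  proof -
    have "(\<lambda>g. - jet (map lab hs) (bracket q g)) =
        - (\<Sum>h\<in>set hs. \<Sum>b\<in>UNIV. ?c h b *\<^sub>R jet (map (lab(h := mate b)) hs))"
      by (simp add: fun_eq_iff sum_form_apply jet_bracket[OF assms(1) d(1)])
    then show ?thesis
      unfolding lie_deriv_one_form
      by (simp only: linear_neg[OF linear_one_form] linear_sum[OF linear_one_form] linear_cmul[OF linear_one_form])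
  qed
  then have "wedge (lie_deriv q (one_form (jet (map lab hs)))) (jets V lab) =
      - (\<Sum>h\<in>set hs. \<Sum>b\<in>UNIV. ?c h b *\<^sub>R wedge (one_form (jet (map (lab(h := mate b)) hs))) (jets V lab))"
    by (simp only: linear_neg[OF linear_wedge_left] linear_sum[OF linear_wedge_left] linear_cmul[OF linear_wedge_left])
  also have "\<dots> = - (\<Sum>h\<in>set hs. \<Sum>b\<in>UNIV. ?c h b *\<^sub>R jets (hs # V) (lab(h := mate b)))"
  proof -
    have "jets V (lab(h := x)) = jets V lab" if "h \<in> set hs" for h x
      unfolding jets_def using d(3) that by (intro arg_cong[of _ _ wedge_list] map_cong refl arg_cong[of _ _ jet]) auto
    then show ?thesis by (simp add: jets_Cons)
  qed
  finally have left: "wedge (lie_deriv q (one_form (jet (map lab hs)))) (jets V lab) =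
      - (\<Sum>h\<in>set hs. \<Sum>b\<in>UNIV. ?c h b *\<^sub>R jets (hs # V) (lab(h := mate b)))" .
  have "wedge (one_form (jet (map lab hs))) (lie_deriv q (jets V lab)) =
      - (\<Sum>h\<in>set (concat V). \<Sum>b\<in>UNIV. ?c h b *\<^sub>R wedge (one_form (jet (map lab hs))) (jets V (lab(h := mate b))))"
    unfolding Cons.IH[OF d(2)]
    by (simp only: linear_neg[OF linear_wedge_right] linear_sum[OF linear_wedge_right] linear_cmul[OF linear_wedge_right])
  also have "\<dots> = - (\<Sum>h\<in>set (concat V). \<Sum>b\<in>UNIV. ?c h b *\<^sub>R jets (hs # V) (lab(h := mate b)))"
  proof -
    have "map (lab(h := x)) hs = map lab hs" if "h \<in> set (concat V)" for h x
      using d(3) that by auto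
    then show ?thesis unfolding jets_Cons by (intro arg_cong[of _ _ uminus] sum.cong refl) metis
  qed
  finally have right: "wedge (one_form (jet (map lab hs))) (lie_deriv q (jets V lab)) =
      - (\<Sum>h\<in>set (concat V). \<Sum>b\<in>UNIV. ?c h b *\<^sub>R jets (hs # V) (lab(h := mate b)))" .
  have "lie_deriv q (jets (hs # V) lab) = wedge (lie_deriv q (one_form (jet (map lab hs)))) (jets V lab) +
      wedge (one_form (jet (map lab hs))) (lie_deriv q (jets V lab))"
    unfolding jets_Cons by (rule ext) (simp add: lie_deriv_wedge)
  then show ?case
    by (simp only: left right concat.simps set_append sum.union_disjoint[OF finite_set finite_set d(3)] minus_add_distrib)
qed

text \<open>
  Contraction with the Poisson tensor along the first \<open>n\<close> edges, where edge \<open>k\<close> joins the half-edges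
  \<open>2k\<close> and \<open>2k + 1\<close>.  The labelling that is passed along only matters at half-edges that are not
  glued.
\<close>

fun glue :: "nat \<Rightarrow> ((nat \<Rightarrow> 4) \<Rightarrow> 'a) \<Rightarrow> (nat \<Rightarrow> 4) \<Rightarrow> 'a :: real_vector"
  where
    "glue 0 \<Phi> lab = \<Phi> lab"
  | "glue (Suc n) \<Phi> lab = (\<Sum>a\<in>UNIV. eps a *\<^sub>R glue n \<Phi> (lab(2 * n := a, 2 * n + 1 := mate a)))"

text \<open>
  Invariance of the Poisson tensor under the infinitesimal symplectic map with Hessian \<open>H\<close>.
\<close>

lemma symplectic_cancel:
  fixes T :: "4 \<Rightarrow> 4 \<Rightarrow> 'a :: real_vector"
  assumes "\<And>a b. H a b = H b a"
  shows "(\<Sum>a\<in>UNIV. eps a *\<^sub>R ((\<Sum>b\<in>UNIV. (eps b * H a b) *\<^sub>R T (mate b) (mate a)) +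
      (\<Sum>b\<in>UNIV. (eps b * H (mate a) b) *\<^sub>R T a (mate b)))) = 0"
  by (simp add: sum_4 scaleR_add_right scaleR_diff_right assms[of 2 1] assms[of 3 1] assms[of 4 1] assms[of 3 2] assms[of 4 2] assms[of 4 3]
    algebra_simps)

lemma lie_deriv_sum: "lie_deriv q (sum F A) = (\<Sum>a\<in>A. lie_deriv q (F a))"
  and lie_deriv_scaleR: "lie_deriv q (c *\<^sub>R \<sigma>) = c *\<^sub>R lie_deriv q \<sigma>"
proof -
  have l: "linear (lie_deriv q)"
    by (rule linearI) (simp_all add: fun_eq_iff lie_deriv_add lie_deriv_scale)
  show "lie_deriv q (sum F A) = (\<Sum>a\<in>A. lie_deriv q (F a))" "lie_deriv q (c *\<^sub>R \<sigma>) = c *\<^sub>R lie_deriv q \<sigma>"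
    by (rule linear_sum[OF l], rule linear_cmul[OF l])
qed

text \<open>
  Gluing an edge removes the action on its two half-edges, as the two contributions cancel by
  \<open>symplectic_cancel\<close>.  Once all edges are glued, nothing is left.
\<close>

lemma lie_deriv_glue:
  assumes \<Phi>: "\<And>lab. lie_deriv q (\<Phi> lab) =
      - (\<Sum>h<2 * N. \<Sum>b\<in>UNIV. (eps b * hess (potential q) (lab h) b) *\<^sub>R \<Phi> (lab(h := mate b)))"
    and "n \<le> N"
  shows "lie_deriv q (glue n \<Phi> lab) =
      - (\<Sum>h\<in>{2 * n..<2 * N}. \<Sum>b\<in>UNIV. (eps b * hess (potential q) (lab h) b) *\<^sub>R glue n \<Phi> (lab(h := mate b)))"
  using assms(2)
proof (induction n arbitrary: lab)
  case 0
  show ?case by (simp only: glue.simps \<Phi> mult_0_right atLeast0LessThan)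
next
  case (Suc n)
  let ?H = "hess (potential q)"
  let ?l = "\<lambda>a. lab(2 * n := a, 2 * n + 1 := mate a)"
  let ?S = "\<lambda>a h. \<Sum>b\<in>UNIV. (eps b * ?H (?l a h) b) *\<^sub>R glue n \<Phi> ((?l a)(h := mate b))"
  have split: "(\<Sum>h\<in>{2 * n..<2 * N}. ?S a h) = (?S a (2 * n) + ?S a (2 * n + 1)) + (\<Sum>h\<in>{2 * Suc n..<2 * N}. ?S a h)" for a
    using Suc.prems by (simp add: sum.atLeast_Suc_lessThan add.assoc)
  have "lie_deriv q (glue (Suc n) \<Phi> lab) = - (\<Sum>a\<in>UNIV. eps a *\<^sub>R (\<Sum>h\<in>{2 * n..<2 * N}. ?S a h))"
    by (simp only: glue.simps lie_deriv_sum lie_deriv_scaleR Suc.IH[OF Suc_leD[OF Suc.prems]]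
        scaleR_minus_right sum_negf)
  also have "(\<Sum>a\<in>UNIV. eps a *\<^sub>R (\<Sum>h\<in>{2 * n..<2 * N}. ?S a h)) =
      (\<Sum>a\<in>UNIV. eps a *\<^sub>R (?S a (2 * n) + ?S a (2 * n + 1))) +
      (\<Sum>a\<in>UNIV. eps a *\<^sub>R (\<Sum>h\<in>{2 * Suc n..<2 * N}. ?S a h))"
    unfolding split by (simp only: scaleR_add_right sum.distrib)
  also have "(\<Sum>a\<in>UNIV. eps a *\<^sub>R (?S a (2 * n) + ?S a (2 * n + 1))) = 0"
    using symplectic_cancel[of ?H "\<lambda>x y. glue n \<Phi> (lab(2 * n := x, 2 * n + 1 := y))", OF hess_sym]
    by (simp add: fun_upd_twist)
  also have "(\<Sum>a\<in>UNIV. eps a *\<^sub>R (\<Sum>h\<in>{2 * Suc n..<2 * N}. ?S a h)) =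
      (\<Sum>h\<in>{2 * Suc n..<2 * N}. \<Sum>b\<in>UNIV. (eps b * ?H (lab h) b) *\<^sub>R glue (Suc n) \<Phi> (lab(h := mate b)))"
  proof -
    have "(\<Sum>a\<in>UNIV. eps a *\<^sub>R ?S a h) =
        (\<Sum>b\<in>UNIV. (eps b * ?H (lab h) b) *\<^sub>R glue (Suc n) \<Phi> (lab(h := mate b)))"
      if "h \<in> {2 * Suc n..<2 * N}" for h
    proof -
      have "?l a h = lab h" "(?l a)(h := x) = lab(h := x, 2 * n := a, 2 * n + 1 := mate a)" for a x
        using that by (auto simp: fun_eq_iff)
      then have "(\<Sum>a\<in>UNIV. eps a *\<^sub>R ?S a h) = (\<Sum>a\<in>UNIV. \<Sum>b\<in>UNIV.
          (eps a * (eps b * ?H (lab h) b)) *\<^sub>R glue n \<Phi> (lab(h := mate b, 2 * n := a, 2 * n + 1 := mate a)))"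
        by (simp only: scaleR_sum_right scaleR_scaleR)
      also have "\<dots> = (\<Sum>b\<in>UNIV. \<Sum>a\<in>UNIV.
          (eps b * ?H (lab h) b * eps a) *\<^sub>R glue n \<Phi> (lab(h := mate b, 2 * n := a, 2 * n + 1 := mate a)))"
        by (subst sum.swap) (simp only: mult.commute)
      finally show ?thesis
        by (simp only: glue.simps scaleR_sum_right scaleR_scaleR)
    qed
    note h = this
    show ?thesis
      unfolding scaleR_sum_right[of _ _ "{2 * Suc n..<2 * N}"]
      by (subst sum.swap, rule sum.cong[OF refl h])
  qed
  finally show ?case by (simp only: add_0_left)
qed


section \<open>Values on powers of linear forms\<close>

definition linform :: "(4 \<Rightarrow> real) \<Rightarrow> poly4"
  where "linform u = (\<Sum>a\<in>UNIV. Poly_Mapping.single (axis a 1) (u a))"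

lemma pd_linform: "pd i (linform u) = Poly_Mapping.single 0 (u i)"
proof -
  have "pd i (Poly_Mapping.single (axis a 1) (u a)) = (if a = i then Poly_Mapping.single 0 (u i) else 0)" for a
    by (auto simp: pd_single axis_def vec_eq_iff intro!: arg_cong[of _ _ "\<lambda>x. Poly_Mapping.single x (u i)"])
  then show ?thesis
    by (simp add: linform_def linear_sum[OF linear_pd])
qed

lemma pd_linform_power: "pd i (linform u ^ n) = (real n * u i) *\<^sub>R linform u ^ (n - 1)"
proof (induction n)
  case 0
  have "pd i (1 :: poly4) = 0"
    by (rule poly_mapping_eqI) (auto simp: lookup_pd lookup_one when_def vec_eq_iff axis_def)
  then show ?case by simp
next
  case (Suc n)
  have scale: "p * (r *\<^sub>R q) = r *\<^sub>R (p * q)" for p q :: poly4 and r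
    by (simp add: mult.left_commute flip: single_0_mult)
  have "pd i (linform u ^ Suc n) = u i *\<^sub>R linform u ^ n + (real n * u i) *\<^sub>R (linform u * linform u ^ (n - 1))"
    by (simp only: power_Suc pd_mult Suc pd_linform single_0_mult scale)
  then show ?case
    by (cases n) (simp_all add: distrib_right flip: scaleR_add_left)
qed

lemma axis_1_nonzero: "axis a (1 :: nat) \<noteq> 0"
  by (auto simp: vec_eq_iff axis_def)

lemma lookup_linform_0: "Poly_Mapping.lookup (linform u) 0 = 0"
  by (simp add: linform_def lookup_sum lookup_single when_def axis_1_nonzero del: One_nat_def)

lemma derivs_linform_power:
  "Poly_Mapping.lookup (derivs as (linform u ^ n)) 0 =
    (if length as = n then fact n * prod_list (map u as) else 0)"
proof (induction as arbitrary: n)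
  case Nil
  show ?case by (cases n) (simp_all add: lookup_0_mult lookup_linform_0)
next
  case (Cons a as)
  show ?case
    unfolding derivs.simps pd_linform_power linear_cmul[OF linear_derivs] lookup_scaleR Cons
    by (cases n) simp_all
qed

lemma keys_linform_power: "\<alpha> \<in> Poly_Mapping.keys (linform u ^ n) \<Longrightarrow> tdeg \<alpha> = n"
proof (induction n arbitrary: \<alpha>)
  case 0
  then show ?case by (auto simp: tdeg_def split: if_splits)
next
  case (Suc n)
  then obtain \<beta> \<gamma> where "\<alpha> = \<beta> + \<gamma>" "\<beta> \<in> Poly_Mapping.keys (linform u)" "\<gamma> \<in> Poly_Mapping.keys (linform u ^ n)"
    using keys_mult[of "linform u" "linform u ^ n"] by auto
  moreover have "tdeg \<beta> = 1" if "\<beta> \<in> Poly_Mapping.keys (linform u)" for \<beta>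
  proof -
    have "\<beta> \<in> (\<Union>a. Poly_Mapping.keys (Poly_Mapping.single (axis a 1) (u a)))"
      using that unfolding linform_def by (rule subsetD[OF Poly_Mapping.keys_sum, rotated])
    then obtain a where "\<beta> \<in> Poly_Mapping.keys (Poly_Mapping.single (axis a 1) (u a))" by blast
    then have "\<beta> = axis a 1" by (simp split: if_splits)
    then show ?thesis by (simp add: tdeg_def axis_def)
  qed
  ultimately show ?case using Suc.IH by (simp add: tdeg_add)
qed

definition linpow :: "nat \<times> (4 \<Rightarrow> real) \<Rightarrow> ham"
  where "linpow = (\<lambda>(n, u). Ham (linform u ^ n))"

lemma jet_linpow:
  "2 \<le> n \<Longrightarrow> jet as (linpow (n, u)) = (if length as = n then fact n * prod_list (map u as) else 0)"
  using keys_linform_power[of _ u n]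
  by (simp add: jet_def linpow_def Ham_inverse derivs_linform_power)

text \<open>
  The signed sum of \<open>g\<close> over all orderings of \<open>us\<close>, organised by the first element, which is the
  Laplace expansion of a determinant.
\<close>

fun alternant :: "nat \<Rightarrow> ('b list \<Rightarrow> real) \<Rightarrow> 'b list \<Rightarrow> real"
  where
    "alternant 0 g us = (if us = [] then g [] else 0)"
  | "alternant (Suc n) g us =
      (\<Sum>i<length us. (- 1) ^ i * alternant n (\<lambda>vs. g (us ! i # vs)) (take i us @ drop (Suc i) us))"

lemma wedge_one_form_laplace:
  "wedge (one_form z) \<beta> fs = (\<Sum>i<length fs. (- 1) ^ i * (z (fs ! i) * \<beta> (take i fs @ drop (Suc i) fs)))"
proof (induction fs arbitrary: \<beta>)
  case Nil
  show ?case by (simp add: one_form_def)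
next
  case (Cons f fs)
  show ?case
    by (simp add: wedge_one_form_Cons Cons sum.lessThan_Suc_shift contract_def sum_negf del: sum.lessThan_Suc)
qed

lemma alternant_mult: "alternant n (\<lambda>vs. c * g vs) us = c * alternant n g us"
  by (induction n arbitrary: g us) (simp_all add: sum_distrib_left mult_ac)

lemma wedge_list_alternant:
  "wedge_list zs (map \<phi> us) = alternant (length zs) (\<lambda>vs. \<Prod>i<length zs. (zs ! i) (\<phi> (vs ! i))) us"
proof (induction zs arbitrary: us)
  case Nil
  show ?case by (simp add: wedge_list_Nil unit_form_def)
next
  case (Cons z zs)
  have "alternant (length zs) (\<lambda>vs. \<Prod>i<length (z # zs). ((z # zs) ! i) (\<phi> ((v # vs) ! i))) us' =
      z (\<phi> v) * wedge_list zs (map \<phi> us')" for v us'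
    by (simp add: Cons prod.lessThan_Suc_shift alternant_mult del: prod.lessThan_Suc)
  then show ?case
    by (simp add: wedge_list_Cons wedge_one_form_laplace take_map drop_map flip: map_append)
qed

lemma glue_sum: "glue n (\<lambda>lab. \<Sum>i\<in>I. c i * \<Phi> i lab) lab = (\<Sum>i\<in>I. c i * glue n (\<Phi> i) lab)"
  for \<Phi> :: "'i \<Rightarrow> (nat \<Rightarrow> 4) \<Rightarrow> real"
proof (induction n arbitrary: lab)
  case (Suc n)
  show ?case
    by (simp add: Suc sum_distrib_left del: fun_upd_apply) (subst sum.swap, simp add: mult_ac del: fun_upd_apply)
qed simp

lemma glue_alternant:
  "glue n (\<lambda>lab. alternant m (G lab) us) lab = alternant m (\<lambda>vs. glue n (\<lambda>lab. G lab vs) lab) us"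
proof (induction m arbitrary: G us)
  case 0
  have "glue n (\<lambda>_. 0) lab = (0 :: real)"
    using glue_sum[of n "\<lambda>_. 0" "\<lambda>_ _. 0" "{}" lab] by simp
  then show ?case by simp
next
  case (Suc m)
  show ?case by (simp add: glue_sum Suc)
qed

lemma glue_apply: "glue n \<Phi> lab fs = glue n (\<lambda>lab. \<Phi> lab fs) lab"
  for \<Phi> :: "(nat \<Rightarrow> 4) \<Rightarrow> form"
  by (induction n arbitrary: lab) (simp_all add: sum_form_apply del: fun_upd_apply)

definition pairing :: "(4 \<Rightarrow> real) \<Rightarrow> (4 \<Rightarrow> real) \<Rightarrow> real"
  where "pairing u v = (\<Sum>a\<in>UNIV. eps a * (u a * v (mate a)))"

text \<open>
  If the tensor is a product of vectors, one for each half-edge, then each contraction yields the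
  pairing of two vectors.  The half-edges that are not glued keep their factors.
\<close>

lemma glue_prod:
  assumes "n \<le> N"
  shows "glue n (\<lambda>lab. \<Prod>h<2 * N. g h (lab h)) lab =
    (\<Prod>k<n. pairing (g (2 * k)) (g (2 * k + 1))) * (\<Prod>h\<in>{2 * n..<2 * N}. g h (lab h))"
  using assms
proof (induction n arbitrary: lab)
  case 0
  show ?case by (simp add: atLeast0LessThan)
next
  case (Suc n)
  have "(\<Prod>h\<in>{2 * n..<2 * N}. g h ((lab(2 * n := a, 2 * n + 1 := mate a)) h)) =
      g (2 * n) a * g (2 * n + 1) (mate a) * (\<Prod>h\<in>{2 * Suc n..<2 * N}. g h (lab h))" for a
    using Suc.prems by (simp add: prod.atLeast_Suc_lessThan)
  then have "glue (Suc n) (\<lambda>lab. \<Prod>h<2 * N. g h (lab h)) lab = (\<Sum>a\<in>UNIV. eps a *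
      ((\<Prod>k<n. pairing (g (2 * k)) (g (2 * k + 1))) *
        (g (2 * n) a * g (2 * n + 1) (mate a) * (\<Prod>h\<in>{2 * Suc n..<2 * N}. g h (lab h)))))"
    using Suc by (simp only: glue.simps real_scaleR_def Suc_leD)
  then show ?case
    by (simp add: pairing_def sum_distrib_left sum_distrib_right mult_ac)
qed

text \<open>
  A graph is a list of edges \<open>(s, t)\<close> between vertices \<open>0, \<dots>, m - 1\<close>, multiple edges allowed; the
  half-edge \<open>2k\<close> belongs to the first and \<open>2k + 1\<close> to the second end of edge \<open>k\<close>.
\<close>

definition end_of :: "(nat \<times> nat) list \<Rightarrow> nat \<Rightarrow> nat"
  where "end_of es h = (if even h then fst else snd) (es ! (h div 2))"

definition half_edges :: "nat \<Rightarrow> (nat \<times> nat) list \<Rightarrow> nat list list"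
  where "half_edges m es = map (\<lambda>i. filter (\<lambda>h. end_of es h = i) [0..<2 * length es]) [0..<m]"

\<comment> \<open>All half-edges are glued, so the initial labelling is a dummy.\<close>
definition graph_form :: "nat \<Rightarrow> (nat \<times> nat) list \<Rightarrow> form"
  where "graph_form m es = glue (length es) (jets (half_edges m es)) (\<lambda>_. 1)"

lemma end_of_less:
  assumes "\<forall>(s, t)\<in>set es. s < m \<and> t < m" "h < 2 * length es"
  shows "end_of es h < m"
proof -
  have "es ! (h div 2) \<in> set es" using assms(2) by (intro nth_mem) auto
  then show ?thesis using assms(1) by (auto simp: end_of_def)
qed

lemma half_edges_concat:
  assumes "\<forall>(s, t)\<in>set es. s < m \<and> t < m"
  shows "set (concat (half_edges m es)) = {..<2 * length es}" "distinct (concat (half_edges m es))"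
proof -
  show "set (concat (half_edges m es)) = {..<2 * length es}"
    using end_of_less[OF assms] by (auto simp: half_edges_def)
  show "distinct (concat (half_edges m es))"
  proof (induction m)
    case (Suc m)
    have "half_edges (Suc m) es = half_edges m es @ [filter (\<lambda>h. end_of es h = m) [0..<2 * length es]]"
      by (simp add: half_edges_def)
    then show ?case using Suc by (auto simp: half_edges_def)
  qed (simp add: half_edges_def)
qed

lemma glue_in_subspace:
  assumes "subspace S" "\<And>lab. \<Phi> lab \<in> S"
  shows "glue n \<Phi> lab \<in> S"
  by (induction n arbitrary: lab) (simp_all add: assms subspace_sum subspace_scale del: fun_upd_apply)

lemma contract_wedge_list_zero:
  assumes "\<forall>z\<in>set zs. z q = 0"
  shows "contract q (wedge_list zs) = 0"
  using assms
proof (induction zs)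
  case Nil
  show ?case by (simp only: wedge_list_Nil contract_unit_form)
next
  case (Cons z zs)
  have IH: "contract q (wedge_list zs) = 0"
    by (rule Cons.IH) (use Cons.prems in simp)
  have z: "z q = 0" using Cons.prems by simp
  show ?case
  proof
    fix fs
    have "contract q (wedge_list (z # zs)) fs = wedge (one_form z) (wedge_list zs) (q # fs)"
      by (simp only: contract_def wedge_list_Cons)
    then show "contract q (wedge_list (z # zs)) fs = 0 fs"
      by (simp only: wedge_one_form_Cons IH z wedge_zero_right) simp
  qed
qed

text \<open>
  The degrees of the vertices have to be listed in ascending order, because the summands of the space
  of cochains are.  Vertices of degree above 2 make the form vanish on quadratic arguments.
\<close>

lemma graph_form_relative:
  assumes es: "\<forall>(s, t)\<in>set es. s < m \<and> t < m"
    and deg: "map length (half_edges m es) = degree_list ks" "\<forall>l\<in>set (degree_list ks). 2 < l"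
    and ks: "sum_list ks = m" "(\<Sum>i<length ks. ks ! i * i) = w"
  shows "graph_form m es \<in> relative_cochains m w"
proof -
  have "jet (map lab hs) \<in> dual_homogeneous (length hs)" for lab and hs :: "nat list"
    using jet_dual[of "map lab hs"] by simp
  then have "jets (half_edges m es) lab \<in> cochain_summand ks" for lab
    unfolding cochain_summand_def jets_def deg(1)[symmetric]
    by (intro span_base CollectI exI[of _ "map (\<lambda>hs. jet (map lab hs)) (half_edges m es)"] conjI refl)
      (simp add: list.rel_map list_all2_same)
  then have "jets (half_edges m es) lab \<in> cochains m w" for lab
    unfolding cochains_def using ks by (intro span_base) blast
  then have mem: "graph_form m es \<in> cochains m w"
    unfolding graph_form_def cochains_def by (intro glue_in_subspace subspace_span)
  have con: "contract q (graph_form m es) = 0" if "q \<in> homogeneous 2" for q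
  proof -
    have "jet (map lab hs) q = 0" if "hs \<in> set (half_edges m es)" for lab hs
    proof -
      have "length hs \<in> set (degree_list ks)" using that unfolding deg(1)[symmetric] by simp
      then have "2 \<noteq> length (map lab hs)" using deg(2) by auto
      then show ?thesis
        using jet_dual[of "map lab hs"] \<open>q \<in> homogeneous 2\<close> unfolding dual_homogeneous_def by blast
    qed
    then have "contract q (jets (half_edges m es) lab) = 0" for lab
      unfolding jets_def by (intro contract_wedge_list_zero) auto
    moreover have "subspace {\<sigma>. contract q \<sigma> = 0}"
      by (auto simp: subspace_def contract_add contract_scale contract_zero)
    ultimately show ?thesis
      unfolding graph_form_def using glue_in_subspace[of "{\<sigma>. contract q \<sigma> = 0}"] by blast
  qed
  have lie: "lie_deriv q (graph_form m es) = 0" if "q \<in> homogeneous 2" for q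
  proof -
    have "lie_deriv q (jets (half_edges m es) lab) = - (\<Sum>h<2 * length es. \<Sum>b\<in>UNIV.
        (eps b * hess (potential q) (lab h) b) *\<^sub>R jets (half_edges m es) (lab(h := mate b)))" for lab
      using lie_deriv_jets[OF that half_edges_concat(2)[OF es], of lab] unfolding half_edges_concat(1)[OF es] .
    from lie_deriv_glue[of q _ "length es" "length es", OF this] show ?thesis
      by (simp add: graph_form_def)
  qed
  show ?thesis
    using mem con lie by (simp add: relative_cochains_def contract_coboundary coboundary_zero)
qed

lemma alternant_cong:
  assumes "\<And>vs. length vs = n \<Longrightarrow> set vs \<subseteq> set us \<Longrightarrow> g vs = h vs"
  shows "alternant n g us = alternant n h us"
  using assms
proof (induction n arbitrary: g h us)
  case (Suc n)
  have "alternant n (\<lambda>vs. g (us ! i # vs)) (take i us @ drop (Suc i) us) =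
      alternant n (\<lambda>vs. h (us ! i # vs)) (take i us @ drop (Suc i) us)" if "i < length us" for i
  proof (rule Suc.IH)
    fix vs assume "length vs = n" "set vs \<subseteq> set (take i us @ drop (Suc i) us)"
    then show "g (us ! i # vs) = h (us ! i # vs)"
      using that set_take_subset[of i us] set_drop_subset[of "Suc i" us] by (intro Suc.prems) auto
  qed
  then show ?case by simp
qed simp

text \<open>
  The derivative tensor of a power \<open>u^n\<close> of a linear form is \<open>n!\<close> times the \<open>n\<close>-th tensor power of
  \<open>u\<close>, and it vanishes in all other degrees; the condition on the degrees discards the orderings that
  put a power at a vertex of another degree.
\<close>

lemma graph_form_linpow:
  assumes es: "\<forall>(s, t)\<in>set es. s < m \<and> t < m" and us: "\<forall>(n, u)\<in>set us. 2 \<le> n"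
  shows "graph_form m es (map linpow us) = alternant m (\<lambda>vs. if map fst vs = map length (half_edges m es)
    then (\<Prod>v\<leftarrow>vs. fact (fst v)) * (\<Prod>(s, t)\<leftarrow>es. pairing (snd (vs ! s)) (snd (vs ! t))) else 0) us"
proof -
  define V where "V = half_edges m es"
  define N where "N = length es"
  have len: "length V = m" by (simp add: V_def half_edges_def)
  have glue_mult: "glue n (\<lambda>lab. c * \<Phi> lab) lab = c * glue n \<Phi> lab" for n c and \<Phi> :: "(nat \<Rightarrow> 4) \<Rightarrow> real" and lab
    using glue_sum[of n "\<lambda>_. c" "\<lambda>_. \<Phi>" "{()}" lab] by simp
  have "graph_form m es (map linpow us) =
      alternant m (\<lambda>vs. glue N (\<lambda>lab. \<Prod>i<m. jet (map lab (V ! i)) (linpow (vs ! i))) (\<lambda>_. 1)) us"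
    unfolding graph_form_def glue_apply jets_def wedge_list_alternant
    by (simp add: len glue_alternant flip: V_def N_def)
  also have "\<dots> = alternant m (\<lambda>vs. if map fst vs = map length V
    then (\<Prod>v\<leftarrow>vs. fact (fst v)) * (\<Prod>(s, t)\<leftarrow>es. pairing (snd (vs ! s)) (snd (vs ! t))) else 0) us"
  proof (rule alternant_cong)
    fix vs assume vs: "length vs = m" "set vs \<subseteq> set us"
    have jet: "jet (map lab (V ! i)) (linpow (vs ! i)) = (if length (V ! i) = fst (vs ! i)
        then fact (fst (vs ! i)) * prod_list (map (\<lambda>h. snd (vs ! i) (lab h)) (V ! i)) else 0)"
      if "i < m" for i lab
    proof -
      have "vs ! i \<in> set us" using vs that nth_mem by blast
      then have "2 \<le> fst (vs ! i)" using us by auto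
      then show ?thesis
        using jet_linpow[of "fst (vs ! i)" "map lab (V ! i)" "snd (vs ! i)"] by (simp add: o_def)
    qed
    show "glue N (\<lambda>lab. \<Prod>i<m. jet (map lab (V ! i)) (linpow (vs ! i))) (\<lambda>_. 1) =
      (if map fst vs = map length V
        then (\<Prod>v\<leftarrow>vs. fact (fst v)) * (\<Prod>(s, t)\<leftarrow>es. pairing (snd (vs ! s)) (snd (vs ! t))) else 0)"
    proof (cases "map fst vs = map length V")
      case False
      then obtain i where "i < m" "length (V ! i) \<noteq> fst (vs ! i)"
        using vs len by (auto simp: list_eq_iff_nth_eq)
      then have "(\<Prod>i<m. jet (map lab (V ! i)) (linpow (vs ! i))) = 0" for lab
        using jet[of i lab] by (intro prod_zero) auto
      then show ?thesis
        using False glue_mult[of N 0 "\<lambda>_. 0"] by (simp only: if_False mult_zero_left)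
    next
      case True
      have "length (V ! i) = fst (vs ! i)" if "i < m" for i
        using arg_cong[OF True, of "\<lambda>xs. xs ! i"] that vs(1) len by simp
      then have "(\<Prod>i<m. jet (map lab (V ! i)) (linpow (vs ! i))) =
          (\<Prod>i<m. fact (fst (vs ! i))) * (\<Prod>i<m. prod_list (map (\<lambda>h. snd (vs ! i) (lab h)) (V ! i)))" for lab
        by (simp add: jet prod.distrib)
      moreover have "(\<Prod>i<m. prod_list (map (\<lambda>h. snd (vs ! i) (lab h)) (V ! i))) =
          (\<Prod>h<2 * N. snd (vs ! end_of es h) (lab h))" for lab
      proof -
        have "(\<Prod>i<m. prod_list (map (\<lambda>h. snd (vs ! i) (lab h)) (V ! i))) =
            (\<Prod>i<m. \<Prod>h\<in>{h. h \<in> {..<2 * N} \<and> end_of es h = i}. snd (vs ! end_of es h) (lab h))"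
        proof (rule prod.cong[OF refl])
          fix i assume "i \<in> {..<m}"
          then have "V ! i = filter (\<lambda>h. end_of es h = i) [0..<2 * N]"
            by (simp add: V_def half_edges_def N_def)
          then show "prod_list (map (\<lambda>h. snd (vs ! i) (lab h)) (V ! i)) =
              (\<Prod>h\<in>{h. h \<in> {..<2 * N} \<and> end_of es h = i}. snd (vs ! end_of es h) (lab h))"
            by (subst prod.distinct_set_conv_list[symmetric]) (auto intro!: prod.cong)
        qed
        also have "\<dots> = (\<Prod>h<2 * N. snd (vs ! end_of es h) (lab h))"
          by (rule prod.group) (use end_of_less[OF es] in \<open>auto simp: N_def\<close>)
        finally show ?thesis .
      qed
      ultimately have "glue N (\<lambda>lab. \<Prod>i<m. jet (map lab (V ! i)) (linpow (vs ! i))) (\<lambda>_. 1) =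
          (\<Prod>i<m. fact (fst (vs ! i))) *
          (\<Prod>k<N. pairing (snd (vs ! end_of es (2 * k))) (snd (vs ! end_of es (2 * k + 1))))"
        by (simp add: glue_mult glue_prod[where g = "\<lambda>h. snd (vs ! end_of es h)"])
      also have "(\<Prod>k<N. pairing (snd (vs ! end_of es (2 * k))) (snd (vs ! end_of es (2 * k + 1)))) =
          (\<Prod>(s, t)\<leftarrow>es. pairing (snd (vs ! s)) (snd (vs ! t)))"
        by (simp add: prod.list_conv_set_nth end_of_def N_def atLeast0LessThan case_prod_beta)
      also have "(\<Prod>i<m. fact (fst (vs ! i))) = (\<Prod>v\<leftarrow>vs. fact (fst v) :: real)"
        by (simp add: prod.list_conv_set_nth vs(1) atLeast0LessThan)
      finally show ?thesis using True by simp
    qed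
  qed
  finally show ?thesis by (simp only: V_def)
qed


section \<open>The dimensions in weight four\<close>

definition vec4 :: "real \<Rightarrow> real \<Rightarrow> real \<Rightarrow> real \<Rightarrow> 4 \<Rightarrow> real"
  where "vec4 a b c d i = (if i = 1 then a else if i = 2 then b else if i = 3 then c else d)"

lemma pairing_vec4: "pairing (vec4 a b c d) (vec4 a' b' c' d') = a * d' + b * c' - c * b' - d * a'"
  by (simp add: pairing_def sum_4 vec4_def)

text \<open>
  The cubic graphs on four vertices without loops are, up to isomorphism, two triple edges, a
  four-cycle with two opposite edges doubled, and the complete graph.  They correspond to \<open>X^3\<close>,
  \<open>X^2 Y\<close> and \<open>X Y Z\<close>.
\<close>

definition two_thetas :: "(nat \<times> nat) list"
  where "two_thetas = [(0, 1), (0, 1), (0, 1), (2, 3), (2, 3), (2, 3)]"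
definition necklace :: "(nat \<times> nat) list"
  where "necklace = [(0, 1), (0, 1), (2, 3), (2, 3), (0, 2), (1, 3)]"
definition tetrahedron :: "(nat \<times> nat) list"
  where "tetrahedron = [(0, 1), (0, 2), (0, 3), (1, 2), (1, 3), (2, 3)]"

text \<open>
  The only graph without loops whose vertices have degrees 3, 3, 4.
\<close>

definition fat_triangle :: "(nat \<times> nat) list"
  where "fat_triangle = [(0, 1), (0, 2), (0, 2), (1, 2), (1, 2)]"

abbreviation cubes :: "(4 \<Rightarrow> real) list \<Rightarrow> ham list"
  where "cubes us \<equiv> map linpow (map (Pair 3) us)"

lemmas graph_defs = two_thetas_def necklace_def tetrahedron_def fat_triangle_def

lemma edges_bounded:
  "\<forall>(s, t)\<in>set two_thetas. s < 4 \<and> t < 4" "\<forall>(s, t)\<in>set necklace. s < 4 \<and> t < 4"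
  "\<forall>(s, t)\<in>set tetrahedron. s < 4 \<and> t < 4" "\<forall>(s, t)\<in>set fat_triangle. s < 3 \<and> t < 3"
  by (simp_all add: graph_defs)

lemma half_edges_lengths:
  "map length (half_edges 4 two_thetas) = [3, 3, 3, 3]"
  "map length (half_edges 4 necklace) = [3, 3, 3, 3]"
  "map length (half_edges 4 tetrahedron) = [3, 3, 3, 3]"
  "map length (half_edges 3 fat_triangle) = [3, 3, 4]"
  by code_simp+

lemma alternant_short:
  "alternant (Suc n) g [a] = alternant n (\<lambda>vs. g (a # vs)) []"
  "alternant (Suc n) g [a, b] = alternant n (\<lambda>vs. g (a # vs)) [b] - alternant n (\<lambda>vs. g (b # vs)) [a]"
  "alternant (Suc n) g [a, b, c] = alternant n (\<lambda>vs. g (a # vs)) [b, c]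
    - alternant n (\<lambda>vs. g (b # vs)) [a, c] + alternant n (\<lambda>vs. g (c # vs)) [a, b]"
  "alternant (Suc n) g [a, b, c, d] = alternant n (\<lambda>vs. g (a # vs)) [b, c, d]
    - alternant n (\<lambda>vs. g (b # vs)) [a, c, d] + alternant n (\<lambda>vs. g (c # vs)) [a, b, d]
    - alternant n (\<lambda>vs. g (d # vs)) [a, b, c]"
  by simp_all

lemma alternant_3: "alternant 3 g [a, b, c] = g [a, b, c] - g [a, c, b] - g [b, a, c] + g [b, c, a] + g [c, a, b] - g [c, b, a]"
  by (simp add: eval_nat_numeral alternant_short del: alternant.simps(2))

lemma alternant_4: "alternant 4 g [a, b, c, d] = g [a, b, c, d] - g [a, b, d, c] - g [a, c, b, d] + g [a, c, d, b] + g [a, d, b, c] - g [a, d, c, b]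
    - g [b, a, c, d] + g [b, a, d, c] + g [b, c, a, d] - g [b, c, d, a] - g [b, d, a, c] + g [b, d, c, a]
    + g [c, a, b, d] - g [c, a, d, b] - g [c, b, a, d] + g [c, b, d, a] + g [c, d, a, b] - g [c, d, b, a]
    - g [d, a, b, c] + g [d, a, c, b] + g [d, b, a, c] - g [d, b, c, a] - g [d, c, a, b] + g [d, c, b, a]"
  by (simp add: eval_nat_numeral alternant_short del: alternant.simps(2))

text \<open>
  Vectors with \<open>(X, Y, Z)\<close> equal to \<open>(1, 0, 0)\<close>, \<open>(2, -1, 0)\<close> and \<open>(1, -1, 1)\<close>, chosen such
  that the matrix of values of the three graph forms is triangular: at the first frame only the cubes
  contribute, and at the second \<open>X Y Z = 0\<close> while \<open>X^2 Y + X Y^2 = -2\<close>.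
\<close>

abbreviation "frame1 \<equiv> cubes [vec4 1 0 0 0, vec4 0 0 0 1, vec4 0 1 0 0, vec4 0 0 1 0]"
abbreviation "frame2 \<equiv> cubes [vec4 1 0 0 0, vec4 0 0 0 1, vec4 0 1 0 1, vec4 (- 1) 0 1 0]"
abbreviation "frame3 \<equiv> cubes [vec4 1 0 0 0, vec4 0 0 0 1, vec4 (- 1) 1 0 1, vec4 (- 1) 0 1 1]"

lemma graph_form_frames:
  "graph_form 4 two_thetas frame1 \<noteq> 0" "graph_form 4 necklace frame1 = 0" "graph_form 4 tetrahedron frame1 = 0"
  "graph_form 4 necklace frame2 \<noteq> 0" "graph_form 4 tetrahedron frame2 = 0"
  "graph_form 4 tetrahedron frame3 \<noteq> 0"
  by (subst graph_form_linpow, rule edges_bounded, simp, simp only: half_edges_lengths alternant_4 list.map,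
      simp add: pairing_vec4 graph_defs)+

lemma graph_form_fat_triangle_nonzero:
  "graph_form 3 fat_triangle (map linpow [(3, vec4 1 0 0 0), (3, vec4 0 0 0 1), (4, vec4 (- 1) 0 0 1)]) \<noteq> 0"
  by (subst graph_form_linpow, rule edges_bounded, simp, simp only: half_edges_lengths alternant_3,
      simp add: pairing_vec4 graph_defs)

text \<open>
  The ambient space of all forms has infinite dimension.  An evaluation map \<open>E\<close> that is injective on
  \<open>S\<close> carries independent sets to a Euclidean space, where their size is bounded.
\<close>

lemma card_independent_le_DIM:
  fixes E :: "'a :: real_vector \<Rightarrow> 'b :: euclidean_space"
  assumes "linear E" "subspace S" "\<And>x. x \<in> S \<Longrightarrow> E x = 0 \<Longrightarrow> x = 0"
    and "independent B" "B \<subseteq> S"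
  shows "finite B \<and> card B \<le> DIM('b)"
proof -
  have "inj_on E S"
  proof (rule inj_onI)
    fix x y assume "x \<in> S" "y \<in> S" "E x = E y"
    then have "x - y \<in> S" "E (x - y) = 0"
      using assms(1,2) by (simp_all add: subspace_diff linear_diff)
    then show "x = y" using assms(3) by force
  qed
  moreover have "span B \<subseteq> S" using assms(2,5) by (simp add: span_minimal)
  ultimately have inj: "inj_on E (span B)" by (rule inj_on_subset)
  then have "independent (E ` B)"
    using assms(1,4) by (intro linear_independent_injective_image)
  then have bound: "finite (E ` B)" "card (E ` B) \<le> DIM('b)"
    using independent_bound by blast+
  have "inj_on E B" using inj by (rule inj_on_subset) (simp add: span_superset)
  then show ?thesis using bound by (simp add: card_image finite_image_iff)
qed

lemma dim_eq_DIM: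
  fixes E :: "'a :: real_vector \<Rightarrow> 'b :: euclidean_space"
  assumes "linear E" "subspace S" "\<And>x. x \<in> S \<Longrightarrow> E x = 0 \<Longrightarrow> x = 0"
    and A: "independent A" "A \<subseteq> S" "card A = DIM('b)"
  shows "dim S = DIM('b)"
proof -
  obtain B where B: "B \<subseteq> S" "independent B" "S \<subseteq> span B" "card B = dim S"
    by (rule basis_exists)
  have fin: "finite B" "card B \<le> DIM('b)"
    using card_independent_le_DIM[OF assms(1-3) B(2,1)] by auto
  have "card A \<le> card B"
    using independent_span_bound[OF fin(1) A(1)] A(2) B(3) by blast
  then show ?thesis using fin(2) A(3) B(4) by simp
qed

lemma span_vanish:
  assumes "\<sigma> \<in> span X" "\<And>\<tau>. \<tau> \<in> X \<Longrightarrow> \<tau> fs = 0"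
  shows "(\<sigma> :: form) fs = 0"
proof -
  have "subspace {\<sigma> :: form. \<sigma> fs = 0}" by (simp add: subspace_def)
  then have "span X \<subseteq> {\<sigma>. \<sigma> fs = 0}" using assms(2) by (intro span_minimal) auto
  then show ?thesis using assms(1) by blast
qed

lemma independent_graph_forms:
  "independent {graph_form 4 two_thetas, graph_form 4 necklace, graph_form 4 tetrahedron}"
  "card {graph_form 4 two_thetas, graph_form 4 necklace, graph_form 4 tetrahedron} = 3"
proof -
  let ?a = "graph_form 4 two_thetas" and ?b = "graph_form 4 necklace" and ?c = "graph_form 4 tetrahedron"
  have a: "?a \<notin> span {?b, ?c}"
    using span_vanish[of ?a "{?b, ?c}" frame1] graph_form_frames(1-3) by blast
  have b: "?b \<notin> span {?c}"
    using span_vanish[of ?b "{?c}" frame2] graph_form_frames(4,5) by blast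
  have c: "?c \<notin> span {}"
    using span_vanish[of ?c "{}" frame3] graph_form_frames(6) by blast
  have "independent {?c}" using c independent_insertI[OF c independent_empty] by blast
  then have "independent {?b, ?c}" by (rule independent_insertI[OF b])
  then show "independent {?a, ?b, ?c}" by (rule independent_insertI[OF a])
  have "?a \<noteq> ?b" "?a \<noteq> ?c" "?b \<noteq> ?c"
    using a b span_base[of ?b "{?b, ?c}"] span_base[of ?c "{?b, ?c}"] span_base[of ?c "{?c}"] by auto
  then show "card {?a, ?b, ?c} = 3" by simp
qed

lemma graph_form_relative_4:
  "graph_form 4 two_thetas \<in> relative_cochains 4 4" "graph_form 4 necklace \<in> relative_cochains 4 4"
  "graph_form 4 tetrahedron \<in> relative_cochains 4 4" "graph_form 3 fat_triangle \<in> relative_cochains 3 4"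
proof -
  have d: "degree_list [0, 4] = [3, 3, 3, 3]" "degree_list [0, 2, 1] = [3, 3, 4]"
    by code_simp+
  note cubic = graph_form_relative[where ks = "[0, 4]" and m = 4 and w = 4]
  show "graph_form 4 two_thetas \<in> relative_cochains 4 4"
    by (rule cubic[OF edges_bounded(1)]) (simp_all add: half_edges_lengths d)
  show "graph_form 4 necklace \<in> relative_cochains 4 4"
    by (rule cubic[OF edges_bounded(2)]) (simp_all add: half_edges_lengths d)
  show "graph_form 4 tetrahedron \<in> relative_cochains 4 4"
    by (rule cubic[OF edges_bounded(3)]) (simp_all add: half_edges_lengths d)
  show "graph_form 3 fat_triangle \<in> relative_cochains 3 4"
    by (rule graph_form_relative[where ks = "[0, 2, 1]", OF edges_bounded(4)])
      (simp_all add: half_edges_lengths d d[unfolded One_nat_def] lessThan_nat_numeral)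
qed

lemma relative_invariant: "\<sigma> \<in> relative_cochains m w \<Longrightarrow> invariant \<sigma>"
  using relative_cochains_horizontal(2) by (auto simp: invariant_def)

lemma relative_weight_4_trivial:
  assumes "m \<noteq> 3" "m \<noteq> 4"
  shows "relative_cochains m 4 = {0}"
proof -
  have "\<sigma> = 0" if "\<sigma> \<in> relative_cochains m 4" for \<sigma>
  proof -
    have hor: "horizontal m (2 * int m + 4) \<sigma>" and inv: "invariant \<sigma>"
      using relative_cochains_horizontal(1)[OF that] relative_invariant[OF that] by simp_all
    consider "m = 0" | "m = 1" | "m = 2" | "4 < m" using assms by linarith
    then show ?thesis
    proof cases
      case 1
      then show ?thesis using hor by (intro horizontal_0_form_zero[of "2 * int m + 4"]) auto
    next
      case 2
      then show ?thesis using hor inv by (intro invariant_1_form_zero) auto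
    next
      case 3
      then show ?thesis using hor inv by (intro invariant_2_form_zero) auto
    next
      case 4
      then show ?thesis using hor by (intro horizontal_zero_if_weight_small[of m "2 * int m + 4"]) auto
    qed
  qed
  then show ?thesis using subspace_0[OF subspace_relative_cochains, of m 4] by auto
qed

lemma linear_eval: "linear (\<lambda>\<sigma>. \<sigma> fs :: real)" for fs :: "ham list"
  by (rule linearI) simp_all

lemma dim_relative_3: "dim (relative_cochains 3 4) = 1"
proof -
  let ?E = "\<lambda>\<sigma>. \<sigma> [mon 3 0 0 0, mon 0 0 0 3, mon 2 0 0 2] :: real"
  have "dim (relative_cochains 3 4) = DIM(real)"
  proof (rule dim_eq_DIM[of ?E])
    fix \<sigma> assume "\<sigma> \<in> relative_cochains 3 4" "?E \<sigma> = 0"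
    then show "\<sigma> = 0"
      using relative_cochains_horizontal(1)[of \<sigma> 3 4] relative_invariant
      by (intro invariant_3_form_zero) (simp_all add: eval_nat_numeral)
  next
    have "graph_form 3 fat_triangle \<noteq> 0" using graph_form_fat_triangle_nonzero by (metis zero_fun_def)
    then show "independent {graph_form 3 fat_triangle}" by (simp add: dependent_single)
  qed (use graph_form_relative_4 in \<open>auto simp: linear_eval subspace_relative_cochains\<close>)
  then show ?thesis by simp
qed

lemma dim_relative_4: "dim (relative_cochains 4 4) = 3"
proof -
  let ?E = "\<lambda>\<sigma>. (slice \<sigma> 0 0 3, slice \<sigma> 1 0 2, slice \<sigma> 2 1 0)"
  have "dim (relative_cochains 4 4) = DIM(real \<times> real \<times> real)"
  proof (rule dim_eq_DIM[of ?E])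
    show "linear ?E" by (rule linearI) simp_all
    fix \<sigma> assume "\<sigma> \<in> relative_cochains 4 4" "?E \<sigma> = 0"
    then show "\<sigma> = 0"
      using relative_cochains_horizontal(1)[of \<sigma> 4 4] relative_invariant
      by (intro invariant_4_form_zero) (simp_all add: zero_prod_def)
  next
    show "independent {graph_form 4 two_thetas, graph_form 4 necklace, graph_form 4 tetrahedron}"
      by (rule independent_graph_forms)
  qed (use graph_form_relative_4 independent_graph_forms(2) in \<open>auto simp: subspace_relative_cochains\<close>)
  then show ?thesis by simp
qed

theorem proposition4:
  shows "dim (relative_cochains 0 4) = 0 \<and>
    dim (relative_cochains 1 4) = 0 \<and>
    dim (relative_cochains 2 4) = 0 \<and>
    dim (relative_cochains 3 4) = 1 \<and>
    dim (relative_cochains 4 4) = 3 \<and>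
    euler_number 4 = (- 1) ^ 0 * 0 + (- 1) ^ 3 * 1 + (- 1) ^ 4 * 3 \<and>
    euler_number 4 = 2"
proof -
  have zero: "dim (relative_cochains m 4) = 0" if "m \<noteq> 3" "m \<noteq> 4" for m
    using dim_eq_card[of "{}" "{0 :: form}"] independent_empty by (simp add: relative_weight_4_trivial[OF that])
  have "euler_number 4 = (\<Sum>m\<in>{3, 4}. (- 1) ^ m * int (dim (relative_cochains m 4)))"
    unfolding euler_number_def
  proof (rule Sum_any.expand_superset)
    show "{m. (- 1) ^ m * int (dim (relative_cochains m 4)) \<noteq> 0} \<subseteq> {3, 4}"
      by (rule subsetI, rule ccontr) (use zero in auto)
  qed simp
  then have "euler_number 4 = 2" by (simp add: dim_relative_3 dim_relative_4)
  then show ?thesis using zero dim_relative_3 dim_relative_4 by simp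
qed

end
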